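(* Let $\mathbb{P}$ be a prop, let $\mathcal{C}$ be a symmetric monoidal category, let $s$ be a supply of $\mathbb{P}$ in $\mathcal{C}$, and let $\overline{s}$ be the induced supply of $\mathbb{P}$ in the strictification $\overline{\mathcal{C}}$. Then the equivalence $\bigotimes\colon\overline{\mathcal{C}}\to\mathcal{C}$ preserves the supply.
   Context: Strong monoidal functors between symmetric monoidal categories are always understood to be symmetric; the structure isomorphisms $\varphi\colon I_{\mathcal{D}}\to F(I_{\mathcal{C}})$ and $\varphi_{c,c'}\colon F(c)\otimes F(c')\to F(c\otimes c')$ are called strongators. In a symmetric monoidal category $(\mathcal{C},I,\otimes)$, write $b^{\otimes m}$ for the left-bracketed $m$-fold product $((b\otimes b)\otimes\cdots)\otimes b$, with $b^{\otimes 0}=I$ and $b^{\otimes 1}=b$. Write $\sigma\colon c^{\otimes n}\otimes d^{\otimes n}\to(c\otimes d)^{\otimes n}$ and $\sigma\colon I\to I^{\otimes n}$ for the canonical (Mac Lane coherence) isomorphisms, the first one realizing the evident shuffle permutation. A prop is a symmetric strict monoidal category whose monoid of objects is $(\mathbb{N},0,+)$. A supply $s$ of a prop $\mathbb{P}$ in $\mathcal{C}$ consists of a strong monoidal functor $s_c\colon\mathbb{P}\to\mathcal{C}$ for each object $c\in\mathcal{C}$ such that: (i) $s_c(m)=c^{\otimes m}$ for each $m\in\mathbb{N}$; (ii) the strongator $c^{\otimes m}\otimes c^{\otimes n}\to c^{\otimes(m+n)}$ is the unique coherence (rebracketing) isomorphism for each $m,n$; (iii) for all $c,d\in\mathcal{C}$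 and $\mu\colon m\to n$ in $\mathbb{P}$, $s_{c\otimes d}(\mu)\circ\sigma=\sigma\circ(s_c(\mu)\otimes s_d(\mu))$ as maps $c^{\otimes m}\otimes d^{\otimes m}\to(c\otimes d)^{\otimes n}$, and $s_I(\mu)\circ\sigma=\sigma$ as maps $I\to I^{\otimes n}$. Given supplies $s$ of $\mathbb{P}$ in $\mathcal{C}$ and $t$ of $\mathbb{P}$ in $\mathcal{D}$, a strong monoidal functor $(F,\varphi)\colon\mathcal{C}\to\mathcal{D}$ preserves the supply if for each $c\in\mathcal{C}$ and $\mu\colon m\to n$ in $\mathbb{P}$ one has $\varphi\circ t_{F(c)}(\mu)=F(s_c(\mu))\circ\varphi$ as maps $F(c)^{\otimes m}\to F(c^{\otimes n})$, where $\varphi\colon F(c)^{\otimes k}\to F(c^{\otimes k})$ denotes the iterated strongator. Strictification. $\overline{\mathcal{C}}$ is Mac Lane's strictification: its objects are finite lists $[c_1,\dots,c_k]$ ($k\ge 0$) of objects of $\mathcal{C}$; a morphism $[c_1,\dots,c_k]\to[d_1,\dots,d_l]$ is a morphism $c_1\otimes\cdots\otimes c_k\to d_1\otimes\cdots\otimes d_l$ in $\mathcal{C}$ (left-bracketed products, the empty product being $I$); the monoidal product, written $\cdot$, is concatenation on objects and is given on morphisms by $\otimes$ in $\mathcal{C}$ conjugated by coherence isomorphisms; the unit is the empty list; and the braiding is induced from that of $\mathcal{C}$. It is a symmetric strict monoidal category, and $\bigotimes\colon\overline{\mathcal{C}}\to\mathcal{C}$, sending a list to its left-bracketed product and each morphism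 to itself, is a strong monoidal equivalence whose strongators are coherence isomorphisms. Induced supply. For $c\in\mathcal{C}$ let $s_{[c]}\colon\mathbb{P}\to\overline{\mathcal{C}}$ send $m$ to the list $[c,\dots,c]$ of length $m$ and $\mu\colon m\to n$ to the unique morphism with $\bigotimes(s_{[c]}(\mu))=s_c(\mu)$. For $c=[c_1,\dots,c_k]\in\overline{\mathcal{C}}$ let $\overline{s}_c(m)=c\cdot\ldots\cdot c$ ($m$ copies), and for $\mu\colon m\to n$ let $\overline{s}_c(\mu)$ be the composite $$c^{\cdot m}\xrightarrow{\ \sigma\ }[c_1,\overset{m}{\ldots},c_1]\cdot\ldots\cdot[c_k,\overset{m}{\ldots},c_k]\xrightarrow{s_{[c_1]}(\mu)\cdot\ldots\cdot s_{[c_k]}(\mu)}[c_1,\overset{n}{\ldots},c_1]\cdot\ldots\cdot[c_k,\overset{n}{\ldots},c_k]\xrightarrow{\ \sigma\ }c^{\cdot n},$$ where the maps $\sigma$ are the canonical symmetry isomorphisms for the evident shuffle permutations. These $\overline{s}_c$ form a supply $\overline{s}$ of $\mathbb{P}$ in $\overline{\mathcal{C}}$, called the induced supply. *)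

theory Defs
  imports Main
begin

section \<open>Symmetric monoidal categories\<close>

text \<open>
  The raw data of a symmetric monoidal category: \<open>\<otimes>\<close> is the monoidal product of objects and
  \<open>\<odot>\<close> that of morphisms, \<open>g \<cdot> f\<close> is composition (\<open>f\<close> first),
  \<open>Assoc a b c : (a \<otimes> b) \<otimes> c \<rightarrow> a \<otimes> (b \<otimes> c)\<close>, \<open>LUnit a : I \<otimes> a \<rightarrow> a\<close>,
  \<open>RUnit a : a \<otimes> I \<rightarrow> a\<close> and \<open>Braid a b : a \<otimes> b \<rightarrow> b \<otimes> a\<close>. All operations are only meaningful
  on members of \<open>Obj\<close> and \<open>Arr\<close> (with matching domains and codomains).
\<close>

record ('o, 'm) smc =
  Obj :: "'o set"
  Arr :: "'m set"
  Dom :: "'m \<Rightarrow> 'o"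
  Cod :: "'m \<Rightarrow> 'o"
  Id :: "'o \<Rightarrow> 'm"
  Comp :: "'m \<Rightarrow> 'm \<Rightarrow> 'm"  (infixr "\<cdot>\<index>" 60)
  TenO :: "'o \<Rightarrow> 'o \<Rightarrow> 'o"  (infixl "\<otimes>\<index>" 70)
  TenM :: "'m \<Rightarrow> 'm \<Rightarrow> 'm"  (infixl "\<odot>\<index>" 70)
  UnitO :: "'o"
  Assoc :: "'o \<Rightarrow> 'o \<Rightarrow> 'o \<Rightarrow> 'm"
  LUnit :: "'o \<Rightarrow> 'm"
  RUnit :: "'o \<Rightarrow> 'm"
  Braid :: "'o \<Rightarrow> 'o \<Rightarrow> 'm"

definition hom :: "('o, 'm) smc \<Rightarrow> 'o \<Rightarrow> 'o \<Rightarrow> 'm set" where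
  "hom C a b = {f \<in> Arr C. Dom C f = a \<and> Cod C f = b}"

definition inverse_arrows :: "('o, 'm) smc \<Rightarrow> 'm \<Rightarrow> 'm \<Rightarrow> bool" where
  "inverse_arrows C f g \<longleftrightarrow>
     f \<in> Arr C \<and> g \<in> hom C (Cod C f) (Dom C f) \<and>
     g \<cdot>\<^bsub>C\<^esub> f = Id C (Dom C f) \<and> f \<cdot>\<^bsub>C\<^esub> g = Id C (Cod C f)"

definition iso :: "('o, 'm) smc \<Rightarrow> 'o \<Rightarrow> 'o \<Rightarrow> 'm \<Rightarrow> bool" where
  "iso C a b f \<longleftrightarrow> f \<in> hom C a b \<and> (\<exists>g. inverse_arrows C f g)"

definition Inv :: "('o, 'm) smc \<Rightarrow> 'm \<Rightarrow> 'm" where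
  "Inv C f = (THE g. inverse_arrows C f g)"

locale category =
  fixes C :: "('o, 'm) smc" (structure)
  assumes Dom_obj: "f \<in> Arr C \<Longrightarrow> Dom C f \<in> Obj C"
    and Cod_obj: "f \<in> Arr C \<Longrightarrow> Cod C f \<in> Obj C"
    and Id_hom: "a \<in> Obj C \<Longrightarrow> Id C a \<in> hom C a a"
    and Comp_hom: "\<lbrakk>f \<in> hom C a b; g \<in> hom C b c\<rbrakk> \<Longrightarrow> g \<cdot> f \<in> hom C a c"
    and Comp_Id: "f \<in> hom C a b \<Longrightarrow> f \<cdot> Id C a = f"
    and Id_Comp: "f \<in> hom C a b \<Longrightarrow> Id C b \<cdot> f = f"
    and Comp_assoc:
      "\<lbrakk>f \<in> hom C a b; g \<in> hom C b c; h \<in> hom C c d\<rbrakk> \<Longrightarrow> (h \<cdot> g) \<cdot> f = h \<cdot> (g \<cdot> f)"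

locale monoidal_category = category C for C :: "('o, 'm) smc" (structure) +
  assumes Unit_obj: "UnitO C \<in> Obj C"
    and Ten_obj: "\<lbrakk>a \<in> Obj C; b \<in> Obj C\<rbrakk> \<Longrightarrow> a \<otimes> b \<in> Obj C"
    and Ten_hom: "\<lbrakk>f \<in> hom C a b; g \<in> hom C c d\<rbrakk> \<Longrightarrow> f \<odot> g \<in> hom C (a \<otimes> c) (b \<otimes> d)"
    and Ten_Id: "\<lbrakk>a \<in> Obj C; b \<in> Obj C\<rbrakk> \<Longrightarrow> Id C a \<odot> Id C b = Id C (a \<otimes> b)"
    and Ten_Comp:
      "\<lbrakk>f \<in> hom C a b; f' \<in> hom C b c; g \<in> hom C a' b'; g' \<in> hom C b' c'\<rbrakk> \<Longrightarrow>
        (f' \<cdot> f) \<odot> (g' \<cdot> g) = (f' \<odot> g') \<cdot> (f \<odot> g)"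
    and Assoc_iso:
      "\<lbrakk>a \<in> Obj C; b \<in> Obj C; c \<in> Obj C\<rbrakk> \<Longrightarrow>
        iso C ((a \<otimes> b) \<otimes> c) (a \<otimes> (b \<otimes> c)) (Assoc C a b c)"
    and LUnit_iso: "a \<in> Obj C \<Longrightarrow> iso C (UnitO C \<otimes> a) a (LUnit C a)"
    and RUnit_iso: "a \<in> Obj C \<Longrightarrow> iso C (a \<otimes> UnitO C) a (RUnit C a)"
    and Assoc_natural:
      "\<lbrakk>f \<in> hom C a a'; g \<in> hom C b b'; h \<in> hom C c c'\<rbrakk> \<Longrightarrow>
        Assoc C a' b' c' \<cdot> ((f \<odot> g) \<odot> h) = (f \<odot> (g \<odot> h)) \<cdot> Assoc C a b c"
    and LUnit_natural:
      "f \<in> hom C a b \<Longrightarrow> LUnit C b \<cdot> (Id C (UnitO C) \<odot> f) = f \<cdot> LUnit C a"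
    and RUnit_natural:
      "f \<in> hom C a b \<Longrightarrow> RUnit C b \<cdot> (f \<odot> Id C (UnitO C)) = f \<cdot> RUnit C a"
    and pentagon:
      "\<lbrakk>a \<in> Obj C; b \<in> Obj C; c \<in> Obj C; d \<in> Obj C\<rbrakk> \<Longrightarrow>
        Assoc C a b (c \<otimes> d) \<cdot> Assoc C (a \<otimes> b) c d =
        (Id C a \<odot> Assoc C b c d) \<cdot> Assoc C a (b \<otimes> c) d \<cdot> (Assoc C a b c \<odot> Id C d)"
    and triangle:
      "\<lbrakk>a \<in> Obj C; b \<in> Obj C\<rbrakk> \<Longrightarrow>
        (Id C a \<odot> LUnit C b) \<cdot> Assoc C a (UnitO C) b = RUnit C a \<odot> Id C b"

locale symmetric_monoidal_category = monoidal_category C for C :: "('o, 'm) smc" (structure) +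
  assumes Braid_hom: "\<lbrakk>a \<in> Obj C; b \<in> Obj C\<rbrakk> \<Longrightarrow> Braid C a b \<in> hom C (a \<otimes> b) (b \<otimes> a)"
    and Braid_natural:
      "\<lbrakk>f \<in> hom C a a'; g \<in> hom C b b'\<rbrakk> \<Longrightarrow>
        Braid C a' b' \<cdot> (f \<odot> g) = (g \<odot> f) \<cdot> Braid C a b"
    and hexagon:
      "\<lbrakk>a \<in> Obj C; b \<in> Obj C; c \<in> Obj C\<rbrakk> \<Longrightarrow>
        Assoc C b c a \<cdot> Braid C a (b \<otimes> c) \<cdot> Assoc C a b c =
        (Id C b \<odot> Braid C a c) \<cdot> Assoc C b a c \<cdot> (Braid C a b \<odot> Id C c)"
    and Braid_Braid:
      "\<lbrakk>a \<in> Obj C; b \<in> Obj C\<rbrakk> \<Longrightarrow> Braid C b a \<cdot> Braid C a b = Id C (a \<otimes> b)"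

locale symmetric_strict_monoidal_category =
  symmetric_monoidal_category C for C :: "('o, 'm) smc" (structure) +
  assumes strict_assoc:
      "\<lbrakk>a \<in> Obj C; b \<in> Obj C; c \<in> Obj C\<rbrakk> \<Longrightarrow> (a \<otimes> b) \<otimes> c = a \<otimes> (b \<otimes> c)"
    and strict_lunit: "a \<in> Obj C \<Longrightarrow> UnitO C \<otimes> a = a"
    and strict_runit: "a \<in> Obj C \<Longrightarrow> a \<otimes> UnitO C = a"
    and Assoc_Id: "\<lbrakk>a \<in> Obj C; b \<in> Obj C; c \<in> Obj C\<rbrakk> \<Longrightarrow> Assoc C a b c = Id C (a \<otimes> b \<otimes> c)"
    and LUnit_Id: "a \<in> Obj C \<Longrightarrow> LUnit C a = Id C a"
    and RUnit_Id: "a \<in> Obj C \<Longrightarrow> RUnit C a = Id C a"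

locale prop_category =
  symmetric_strict_monoidal_category P for P :: "(nat, 'p) smc" +
  assumes Obj_nat: "Obj P = UNIV"
    and Unit_zero: "UnitO P = 0"
    and Ten_add: "m \<otimes>\<^bsub>P\<^esub> n = m + n"


section \<open>Strong monoidal functors\<close>

text \<open>\<open>Str0\<close> and \<open>Str2\<close> are the strongators \<open>I \<rightarrow> F I\<close> and \<open>F a \<otimes> F b \<rightarrow> F (a \<otimes> b)\<close>.\<close>

record ('o, 'm, 'o2, 'm2) mfunctor =
  FO :: "'o \<Rightarrow> 'o2"
  FM :: "'m \<Rightarrow> 'm2"
  Str0 :: "'m2"
  Str2 :: "'o \<Rightarrow> 'o \<Rightarrow> 'm2"

locale strong_monoidal_functor =
  C: symmetric_monoidal_category C + D: symmetric_monoidal_category D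
  for C :: "('o, 'm) smc" and D :: "('o2, 'm2) smc" and F :: "('o, 'm, 'o2, 'm2) mfunctor" +
  assumes FO_obj: "a \<in> Obj C \<Longrightarrow> FO F a \<in> Obj D"
    and FM_hom: "f \<in> hom C a b \<Longrightarrow> FM F f \<in> hom D (FO F a) (FO F b)"
    and FM_Id: "a \<in> Obj C \<Longrightarrow> FM F (Id C a) = Id D (FO F a)"
    and FM_Comp:
      "\<lbrakk>f \<in> hom C a b; g \<in> hom C b c\<rbrakk> \<Longrightarrow> FM F (g \<cdot>\<^bsub>C\<^esub> f) = FM F g \<cdot>\<^bsub>D\<^esub> FM F f"
    and Str0_iso: "iso D (UnitO D) (FO F (UnitO C)) (Str0 F)"
    and Str2_iso:
      "\<lbrakk>a \<in> Obj C; b \<in> Obj C\<rbrakk> \<Longrightarrow>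
        iso D (FO F a \<otimes>\<^bsub>D\<^esub> FO F b) (FO F (a \<otimes>\<^bsub>C\<^esub> b)) (Str2 F a b)"
    and Str2_natural:
      "\<lbrakk>f \<in> hom C a a'; g \<in> hom C b b'\<rbrakk> \<Longrightarrow>
        Str2 F a' b' \<cdot>\<^bsub>D\<^esub> (FM F f \<odot>\<^bsub>D\<^esub> FM F g) = FM F (f \<odot>\<^bsub>C\<^esub> g) \<cdot>\<^bsub>D\<^esub> Str2 F a b"
    and Str_assoc:
      "\<lbrakk>a \<in> Obj C; b \<in> Obj C; c \<in> Obj C\<rbrakk> \<Longrightarrow>
        FM F (Assoc C a b c) \<cdot>\<^bsub>D\<^esub> Str2 F (a \<otimes>\<^bsub>C\<^esub> b) c \<cdot>\<^bsub>D\<^esub> (Str2 F a b \<odot>\<^bsub>D\<^esub> Id D (FO F c)) =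
        Str2 F a (b \<otimes>\<^bsub>C\<^esub> c) \<cdot>\<^bsub>D\<^esub> (Id D (FO F a) \<odot>\<^bsub>D\<^esub> Str2 F b c) \<cdot>\<^bsub>D\<^esub>
          Assoc D (FO F a) (FO F b) (FO F c)"
    and Str_lunit:
      "a \<in> Obj C \<Longrightarrow>
        FM F (LUnit C a) \<cdot>\<^bsub>D\<^esub> Str2 F (UnitO C) a \<cdot>\<^bsub>D\<^esub> (Str0 F \<odot>\<^bsub>D\<^esub> Id D (FO F a)) =
        LUnit D (FO F a)"
    and Str_runit:
      "a \<in> Obj C \<Longrightarrow>
        FM F (RUnit C a) \<cdot>\<^bsub>D\<^esub> Str2 F a (UnitO C) \<cdot>\<^bsub>D\<^esub> (Id D (FO F a) \<odot>\<^bsub>D\<^esub> Str0 F) =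
        RUnit D (FO F a)"
    and Str_braid:
      "\<lbrakk>a \<in> Obj C; b \<in> Obj C\<rbrakk> \<Longrightarrow>
        FM F (Braid C a b) \<cdot>\<^bsub>D\<^esub> Str2 F a b = Str2 F b a \<cdot>\<^bsub>D\<^esub> Braid D (FO F a) (FO F b)"


section \<open>Left-bracketed products and coherence isomorphisms\<close>

fun tens :: "('o, 'm) smc \<Rightarrow> 'o list \<Rightarrow> 'o" where
  "tens C [] = UnitO C"
| "tens C (c # cs) = foldl (TenO C) c cs"

fun tens_mor :: "('o, 'm) smc \<Rightarrow> 'm list \<Rightarrow> 'm" where
  "tens_mor C [] = Id C (UnitO C)"
| "tens_mor C (f # fs) = foldl (TenM C) f fs"

definition pow :: "('o, 'm) smc \<Rightarrow> 'o \<Rightarrow> nat \<Rightarrow> 'o" where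
  "pow C c m = tens C (replicate m c)"

text \<open>
  The coherence isomorphism \<open>tens C as \<otimes> tens C bs \<rightarrow> tens C (as @ bs)\<close>.
  The helper \<open>rebracket_rev\<close> recurses on the reversal of \<open>bs\<close>, because the
  left-bracketed product splits off its last factor; it is the right map only for \<open>as \<noteq> []\<close>.
\<close>

fun rebracket_rev :: "('o, 'm) smc \<Rightarrow> 'o list \<Rightarrow> 'o list \<Rightarrow> 'm" where
  "rebracket_rev C as [] = RUnit C (tens C as)"
| "rebracket_rev C as [b] = Id C (tens C as \<otimes>\<^bsub>C\<^esub> b)"
| "rebracket_rev C as (b # b' # bs) =
     (rebracket_rev C as (b' # bs) \<odot>\<^bsub>C\<^esub> Id C b) \<cdot>\<^bsub>C\<^esub>
     Inv C (Assoc C (tens C as) (tens C (rev (b' # bs))) b)"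

definition rebracket :: "('o, 'm) smc \<Rightarrow> 'o list \<Rightarrow> 'o list \<Rightarrow> 'm" where
  "rebracket C as bs =
     (if as = [] then LUnit C (tens C bs) else rebracket_rev C as (rev bs))"

text \<open>\<open>(a \<otimes> b) \<otimes> (c \<otimes> d) \<rightarrow> (a \<otimes> c) \<otimes> (b \<otimes> d)\<close>, exchanging the two middle factors.\<close>

definition interchange :: "('o, 'm) smc \<Rightarrow> 'o \<Rightarrow> 'o \<Rightarrow> 'o \<Rightarrow> 'o \<Rightarrow> 'm" where
  "interchange C a b c d =
     Inv C (Assoc C a c (b \<otimes>\<^bsub>C\<^esub> d)) \<cdot>\<^bsub>C\<^esub>
     (Id C a \<odot>\<^bsub>C\<^esub>
        (Assoc C c b d \<cdot>\<^bsub>C\<^esub> (Braid C b c \<odot>\<^bsub>C\<^esub> Id C d) \<cdot>\<^bsub>C\<^esub> Inv C (Assoc C b c d))) \<cdot>\<^bsub>C\<^esub>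
     Assoc C a b (c \<otimes>\<^bsub>C\<^esub> d)"

text \<open>
  The canonical isomorphism \<open>\<sigma> : c\<^sup>n \<otimes> d\<^sup>n \<rightarrow> (c \<otimes> d)\<^sup>n\<close>. The recursion step is
  \<open>(c\<^sup>n \<otimes> c) \<otimes> (d\<^sup>n \<otimes> d) \<rightarrow> (c\<^sup>n \<otimes> d\<^sup>n) \<otimes> (c \<otimes> d) \<rightarrow> (c \<otimes> d)\<^sup>n \<otimes> (c \<otimes> d)\<close>: it keeps the
  order of the copies of \<open>c\<close> and of the copies of \<open>d\<close> and alternates them.
\<close>

fun shuffle :: "('o, 'm) smc \<Rightarrow> 'o \<Rightarrow> 'o \<Rightarrow> nat \<Rightarrow> 'm" where
  "shuffle C c d 0 = LUnit C (UnitO C)"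
| "shuffle C c d (Suc 0) = Id C (c \<otimes>\<^bsub>C\<^esub> d)"
| "shuffle C c d (Suc (Suc n)) =
     (shuffle C c d (Suc n) \<odot>\<^bsub>C\<^esub> Id C (c \<otimes>\<^bsub>C\<^esub> d)) \<cdot>\<^bsub>C\<^esub>
     interchange C (pow C c (Suc n)) c (pow C d (Suc n)) d"

text \<open>The canonical isomorphism \<open>\<sigma> : I \<rightarrow> I\<^sup>n\<close>.\<close>

fun unit_shuffle :: "('o, 'm) smc \<Rightarrow> nat \<Rightarrow> 'm" where
  "unit_shuffle C 0 = Id C (UnitO C)"
| "unit_shuffle C (Suc 0) = Id C (UnitO C)"
| "unit_shuffle C (Suc (Suc n)) =
     (unit_shuffle C (Suc n) \<odot>\<^bsub>C\<^esub> Id C (UnitO C)) \<cdot>\<^bsub>C\<^esub> Inv C (LUnit C (UnitO C))"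

text \<open>
  The canonical isomorphism \<open>c\<^sub>1\<^sup>n \<otimes> \<dots> \<otimes> c\<^sub>k\<^sup>n \<rightarrow> (c\<^sub>1 \<otimes> \<dots> \<otimes> c\<^sub>k)\<^sup>n\<close>, the \<open>k\<close>-ary
  version of \<open>\<sigma>\<close>; as above, the helper recurses on the reversed list.
\<close>

fun multi_shuffle_rev :: "('o, 'm) smc \<Rightarrow> 'o list \<Rightarrow> nat \<Rightarrow> 'm" where
  "multi_shuffle_rev C [] n = unit_shuffle C n"
| "multi_shuffle_rev C [c] n = Id C (pow C c n)"
| "multi_shuffle_rev C (c # c' # cs) n =
     shuffle C (tens C (rev (c' # cs))) c n \<cdot>\<^bsub>C\<^esub>
     (multi_shuffle_rev C (c' # cs) n \<odot>\<^bsub>C\<^esub> Id C (pow C c n))"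

definition multi_shuffle :: "('o, 'm) smc \<Rightarrow> 'o list \<Rightarrow> nat \<Rightarrow> 'm" where
  "multi_shuffle C cs n = multi_shuffle_rev C (rev cs) n"


section \<open>Supplies\<close>

locale is_supply =
  P: prop_category P + C: symmetric_monoidal_category C
  for P :: "(nat, 'p) smc" and C :: "('o, 'm) smc" and s :: "'o \<Rightarrow> (nat, 'p, 'o, 'm) mfunctor" +
  assumes supply_functor: "c \<in> Obj C \<Longrightarrow> strong_monoidal_functor P C (s c)"
    and supply_obj: "c \<in> Obj C \<Longrightarrow> FO (s c) m = pow C c m"
    and supply_strongator:
      "c \<in> Obj C \<Longrightarrow> Str2 (s c) m n = rebracket C (replicate m c) (replicate n c)"
    and supply_tensor:
      "\<lbrakk>c \<in> Obj C; d \<in> Obj C; \<mu> \<in> hom P m n\<rbrakk> \<Longrightarrow>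
        FM (s (c \<otimes>\<^bsub>C\<^esub> d)) \<mu> \<cdot>\<^bsub>C\<^esub> shuffle C c d m =
        shuffle C c d n \<cdot>\<^bsub>C\<^esub> (FM (s c) \<mu> \<odot>\<^bsub>C\<^esub> FM (s d) \<mu>)"
    and supply_unit:
      "\<mu> \<in> hom P m n \<Longrightarrow>
        FM (s (UnitO C)) \<mu> \<cdot>\<^bsub>C\<^esub> unit_shuffle C m = unit_shuffle C n"

text \<open>The iterated strongator \<open>(F c)\<^sup>k \<rightarrow> F (c\<^sup>k)\<close>.\<close>

fun iterated_strongator ::
  "('o, 'm) smc \<Rightarrow> ('o2, 'm2) smc \<Rightarrow> ('o, 'm, 'o2, 'm2) mfunctor \<Rightarrow> 'o \<Rightarrow> nat \<Rightarrow> 'm2" where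
  "iterated_strongator C D F c 0 = Str0 F"
| "iterated_strongator C D F c (Suc 0) = Id D (FO F c)"
| "iterated_strongator C D F c (Suc (Suc k)) =
     Str2 F (pow C c (Suc k)) c \<cdot>\<^bsub>D\<^esub>
     (iterated_strongator C D F c (Suc k) \<odot>\<^bsub>D\<^esub> Id D (FO F c))"

locale preserves_supply =
  s: is_supply P C s + t: is_supply P D t + F: strong_monoidal_functor C D F
  for P :: "(nat, 'p) smc"
    and C :: "('o, 'm) smc" and s :: "'o \<Rightarrow> (nat, 'p, 'o, 'm) mfunctor"
    and D :: "('o2, 'm2) smc" and t :: "'o2 \<Rightarrow> (nat, 'p, 'o2, 'm2) mfunctor"
    and F :: "('o, 'm, 'o2, 'm2) mfunctor" +
  assumes preserves:
    "\<lbrakk>c \<in> Obj C; \<mu> \<in> hom P m n\<rbrakk> \<Longrightarrow>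
      iterated_strongator C D F c n \<cdot>\<^bsub>D\<^esub> FM (t (FO F c)) \<mu> =
      FM F (FM (s c) \<mu>) \<cdot>\<^bsub>D\<^esub> iterated_strongator C D F c m"


section \<open>Strictification and the induced supply\<close>

text \<open>
  A morphism \<open>[c\<^sub>1,\<dots>,c\<^sub>k] \<rightarrow> [d\<^sub>1,\<dots>,d\<^sub>l]\<close> is a morphism \<open>f : c\<^sub>1 \<otimes> \<dots> \<otimes> c\<^sub>k \<rightarrow> d\<^sub>1 \<otimes> \<dots> \<otimes> d\<^sub>l\<close>
  tagged with its domain and codomain lists, so that domain and codomain are functions of the
  morphism.
\<close>

definition strictification ::
  "('o, 'm) smc \<Rightarrow> ('o list, 'o list \<times> 'o list \<times> 'm) smc" where
  "strictification C =
    \<lparr>Obj = lists (Obj C),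
     Arr = {(cs, ds, f). cs \<in> lists (Obj C) \<and> ds \<in> lists (Obj C) \<and>
                         f \<in> hom C (tens C cs) (tens C ds)},
     Dom = (\<lambda>(cs, ds, f). cs),
     Cod = (\<lambda>(cs, ds, f). ds),
     Id = (\<lambda>cs. (cs, cs, Id C (tens C cs))),
     Comp = (\<lambda>(ds', es, g) (cs, ds, f). (cs, es, g \<cdot>\<^bsub>C\<^esub> f)),
     TenO = (@),
     TenM = (\<lambda>(cs, ds, f) (cs', ds', g).
       (cs @ cs', ds @ ds',
        rebracket C ds ds' \<cdot>\<^bsub>C\<^esub> (f \<odot>\<^bsub>C\<^esub> g) \<cdot>\<^bsub>C\<^esub> Inv C (rebracket C cs cs'))),
     UnitO = [],
     Assoc = (\<lambda>as bs cs. (as @ bs @ cs, as @ bs @ cs, Id C (tens C (as @ bs @ cs)))),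
     LUnit = (\<lambda>cs. (cs, cs, Id C (tens C cs))),
     RUnit = (\<lambda>cs. (cs, cs, Id C (tens C cs))),
     Braid = (\<lambda>as bs.
       (as @ bs, bs @ as,
        rebracket C bs as \<cdot>\<^bsub>C\<^esub> Braid C (tens C as) (tens C bs) \<cdot>\<^bsub>C\<^esub> Inv C (rebracket C as bs)))\<rparr>"

definition tensor_functor ::
  "('o, 'm) smc \<Rightarrow> ('o list, 'o list \<times> 'o list \<times> 'm, 'o, 'm) mfunctor" where
  "tensor_functor C =
    \<lparr>FO = tens C,
     FM = (\<lambda>(cs, ds, f). f),
     Str0 = Id C (UnitO C),
     Str2 = rebracket C\<rparr>"

text \<open>The morphism \<open>s\<^bsub>[c]\<^esub>(\<mu>)\<close>, for an object \<open>c\<close> of \<open>C\<close>.\<close>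

definition singleton_supply_mor ::
  "(nat, 'p) smc \<Rightarrow> ('o \<Rightarrow> (nat, 'p, 'o, 'm) mfunctor) \<Rightarrow> 'o \<Rightarrow> 'p \<Rightarrow> 'o list \<times> 'o list \<times> 'm" where
  "singleton_supply_mor P s c \<mu> =
     (replicate (Dom P \<mu>) c, replicate (Cod P \<mu>) c, FM (s c) \<mu>)"

text \<open>
  The strongators of the induced supply, not part of the displayed composite, are the ones
  forced by the definition of a supply; as the strictification is strict they are identities.
\<close>

definition induced_supply ::
  "(nat, 'p) smc \<Rightarrow> ('o, 'm) smc \<Rightarrow> ('o \<Rightarrow> (nat, 'p, 'o, 'm) mfunctor) \<Rightarrow>
   'o list \<Rightarrow> (nat, 'p, 'o list, 'o list \<times> 'o list \<times> 'm) mfunctor" where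
  "induced_supply P C s cs =
    (let S = strictification C;
         \<sigma> = multi_shuffle S (map (\<lambda>c. [c]) cs)
     in \<lparr>FO = (\<lambda>m. pow S cs m),
         FM = (\<lambda>\<mu>. \<sigma> (Cod P \<mu>) \<cdot>\<^bsub>S\<^esub>
                    tens_mor S (map (\<lambda>c. singleton_supply_mor P s c \<mu>) cs) \<cdot>\<^bsub>S\<^esub>
                    Inv S (\<sigma> (Dom P \<mu>))),
         Str0 = Id S [],
         Str2 = (\<lambda>m n. Id S (pow S cs (m + n)))\<rparr>)"

end

theory Submission
  imports Defs
begin

text \<open>
  Since the strictification is strict, a supply on it amounts to a family of strict symmetric
  monoidal functors from the prop. Given such functors \<open>f\<close> on \<open>a\<close> and \<open>g\<close> on \<open>b\<close>, conjugating
  \<open>f \<otimes> g\<close> by shuffles yields one on \<open>a \<otimes> b\<close>; this shuffle product is strictly associative and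
  unital, because shuffles are generated by the middle interchange, which makes \<open>\<otimes>\<close> itself a
  symmetric monoidal functor. The induced supply is the shuffle product of the functors attached to
  one-element lists, so it is multiplicative under concatenation. A strong monoidal functor
  carries interchanges to interchanges, hence shuffles to shuffles; therefore preservation of
  supplies passes from \<open>c\<close> and \<open>d\<close> to \<open>c \<otimes> d\<close>. It is immediate for one-element lists and for the
  empty list, and induction on lists finishes the argument.
\<close>

section \<open>Calculus of arrows\<close>

text \<open>No coherence theorem is quoted. The central fact about brackets is the cocycle identity
  \<open>rebracket_assoc\<close>, proved by induction from pentagon and triangle; associativity of
  the product of arrows in the strictification, its hexagon and the monoidality of the tensor
  functor all rest on it. The algebra of shuffles (sums of exponents, triple products) is developed
  only in strict categories, where an interchange is one braiding flanked by identities; in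
  \<open>C\<close> itself the recursion of the shuffles and naturality of the interchange suffice.
  Two points shape the statements. By \<open>supply_strongator\<close> the strongators of
  \<open>s c\<close> are the very maps by which the strictification conjugates its product of
  arrows, which is why one-element lists carry strict functors. And a left-bracketed product has no
  leading unit, so appending an object is tensoring with identity strongator only for a nonempty
  list. The passage from \<open>c\<close> and \<open>d\<close> to \<open>c \<otimes> d\<close> is
  therefore stated for an identity strongator, and the induction on lists treats length one
  separately.\<close>

definition invertible :: "('o, 'm) smc \<Rightarrow> 'm \<Rightarrow> bool" where
  "invertible C f \<longleftrightarrow> (\<exists>g. inverse_arrows C f g)"

lemma iso_iff: "iso C a b f \<longleftrightarrow> invertible C f \<and> Dom C f = a \<and> Cod C f = b"
  by (auto simp: iso_def invertible_def hom_def inverse_arrows_def)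

lemma in_hom_iff: "f \<in> hom C a b \<longleftrightarrow> f \<in> Arr C \<and> Dom C f = a \<and> Cod C f = b"
  by (auto simp: hom_def)

lemma invertible_arr: "invertible C f \<Longrightarrow> f \<in> Arr C"
  by (auto simp: invertible_def inverse_arrows_def)

context category
begin

lemma Dom_Obj [simp]: "f \<in> Arr C \<Longrightarrow> Dom C f \<in> Obj C"
  and Cod_Obj [simp]: "f \<in> Arr C \<Longrightarrow> Cod C f \<in> Obj C"
  by (simp_all add: Dom_obj Cod_obj)

lemma Id_arr [simp]:
  assumes "a \<in> Obj C"
  shows "Id C a \<in> Arr C" "Dom C (Id C a) = a" "Cod C (Id C a) = a"
  using Id_hom[OF assms] by (auto simp: hom_def)

lemma Comp_arr [simp]:
  assumes "f \<in> Arr C" "g \<in> Arr C" "Cod C f = Dom C g"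
  shows "g \<cdot> f \<in> Arr C" "Dom C (g \<cdot> f) = Dom C f" "Cod C (g \<cdot> f) = Cod C g"
  using Comp_hom[of f "Dom C f" "Cod C f" g "Cod C g"] assms by (auto simp: hom_def)

lemma Comp_Id_right [simp]: "f \<in> Arr C \<Longrightarrow> Dom C f = a \<Longrightarrow> f \<cdot> Id C a = f"
  and Comp_Id_left [simp]: "f \<in> Arr C \<Longrightarrow> Cod C f = a \<Longrightarrow> Id C a \<cdot> f = f"
  using Comp_Id Id_Comp by (auto simp: hom_def)

lemma Comp_assoc_arr:
  "\<lbrakk>f \<in> Arr C; g \<in> Arr C; h \<in> Arr C; Cod C f = Dom C g; Cod C g = Dom C h\<rbrakk> \<Longrightarrow>
    (h \<cdot> g) \<cdot> f = h \<cdot> (g \<cdot> f)"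
  using Comp_assoc by (auto simp: hom_def)

text \<open>Composites are kept bracketed to the right, so an equation between two-fold composites
  does not match inside a longer one. This lemma and \<open>Comp_rewrite2\<close> produce the
  version with a tail \<open>x\<close>, from which the primed rewrite rules such as
  \<open>Comp_Ten'\<close> and \<open>Assoc_nat'\<close> come.\<close>

lemma Comp_rewrite:
  assumes "g \<cdot> f = h" "f \<in> Arr C" "g \<in> Arr C" "Cod C f = Dom C g" "x \<in> Arr C" "Cod C x = Dom C f"
  shows "g \<cdot> (f \<cdot> x) = h \<cdot> x"
  using assms Comp_assoc_arr by metis

lemma Comp_rewrite2:
  assumes "g \<cdot> f = h \<cdot> k" "f \<in> Arr C" "g \<in> Arr C" "Cod C f = Dom C g"
    "h \<in> Arr C" "k \<in> Arr C" "Cod C k = Dom C h" "x \<in> Arr C" "Cod C x = Dom C f"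
  shows "g \<cdot> (f \<cdot> x) = h \<cdot> (k \<cdot> x)"
  using assms Comp_assoc_arr Comp_arr by metis

lemma inverse_arrows_unique:
  assumes "inverse_arrows C f g" "inverse_arrows C f h"
  shows "g = h"
proof -
  have "g = g \<cdot> (f \<cdot> h)"
    using assms by (auto simp: inverse_arrows_def hom_def)
  also have "\<dots> = (g \<cdot> f) \<cdot> h"
    using assms by (subst Comp_assoc_arr) (auto simp: inverse_arrows_def hom_def)
  also have "\<dots> = h"
    using assms by (auto simp: inverse_arrows_def hom_def)
  finally show ?thesis .
qed

lemma inverse_arrows_Inv: "invertible C f \<Longrightarrow> inverse_arrows C f (Inv C f)"
  unfolding invertible_def Inv_def
  by (rule theI') (auto intro: inverse_arrows_unique)

lemma Inv_eqI: "inverse_arrows C f g \<Longrightarrow> Inv C f = g"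
  using inverse_arrows_Inv inverse_arrows_unique invertible_def by metis

lemma Inv_arr [simp]:
  assumes "invertible C f"
  shows "Inv C f \<in> Arr C" "Dom C (Inv C f) = Cod C f" "Cod C (Inv C f) = Dom C f"
    "Inv C f \<cdot> f = Id C (Dom C f)" "f \<cdot> Inv C f = Id C (Cod C f)"
  using inverse_arrows_Inv[OF assms] by (auto simp: inverse_arrows_def hom_def)

lemma Inv_cancel [simp]:
  assumes "invertible C f" "x \<in> Arr C"
  shows "Cod C x = Dom C f \<Longrightarrow> Inv C f \<cdot> (f \<cdot> x) = x"
    "Cod C x = Cod C f \<Longrightarrow> f \<cdot> (Inv C f \<cdot> x) = x"
  using assms invertible_arr[OF assms(1)]
  by (metis Comp_Id_left Comp_assoc_arr Inv_arr)+

lemma inverse_arrows_sym: "inverse_arrows C f g \<Longrightarrow> inverse_arrows C g f"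
  by (auto simp: inverse_arrows_def hom_def)

lemma invertible_Inv [simp]: "invertible C f \<Longrightarrow> invertible C (Inv C f)"
  using inverse_arrows_Inv inverse_arrows_sym invertible_def by metis

lemma inverse_arrows_Id: "a \<in> Obj C \<Longrightarrow> inverse_arrows C (Id C a) (Id C a)"
  by (auto simp: inverse_arrows_def hom_def)

lemma invertible_Id [simp]: "a \<in> Obj C \<Longrightarrow> invertible C (Id C a)"
  using inverse_arrows_Id invertible_def by metis

lemma Inv_Id [simp]: "a \<in> Obj C \<Longrightarrow> Inv C (Id C a) = Id C a"
  by (simp add: inverse_arrows_Id Inv_eqI)

lemma inverse_arrows_Comp:
  assumes "invertible C f" "invertible C g" "Cod C f = Dom C g"
  shows "inverse_arrows C (g \<cdot> f) (Inv C f \<cdot> Inv C g)"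
  using assms invertible_arr[OF assms(1)] invertible_arr[OF assms(2)]
  by (auto simp: inverse_arrows_def hom_def Comp_assoc_arr)

lemma invertible_Comp [simp]:
  "invertible C f \<Longrightarrow> invertible C g \<Longrightarrow> Cod C f = Dom C g \<Longrightarrow> invertible C (g \<cdot> f)"
  using inverse_arrows_Comp invertible_def by metis

lemma Inv_Comp:
  "invertible C f \<Longrightarrow> invertible C g \<Longrightarrow> Cod C f = Dom C g \<Longrightarrow>
    Inv C (g \<cdot> f) = Inv C f \<cdot> Inv C g"
  by (simp add: inverse_arrows_Comp Inv_eqI)

lemma cancel_right:
  assumes "f \<cdot> e = g \<cdot> e" "invertible C e" "f \<in> Arr C" "g \<in> Arr C" "Dom C f = Cod C e" "Dom C g = Cod C e"
  shows "f = g"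
proof -
  have "f = (f \<cdot> e) \<cdot> Inv C e"
    using assms invertible_arr[OF assms(2)] by (subst Comp_assoc_arr) auto
  also have "\<dots> = g"
    unfolding assms(1) using assms(2-) invertible_arr[OF assms(2)] by (subst Comp_assoc_arr) auto
  finally show ?thesis .
qed

lemma cancel_left:
  assumes "e \<cdot> f = e \<cdot> g" "invertible C e" "f \<in> Arr C" "g \<in> Arr C" "Cod C f = Dom C e" "Cod C g = Dom C e"
  shows "f = g"
  using assms Inv_cancel(1) by metis

lemma eq_Comp_Inv:
  assumes "f \<cdot> e = g" "invertible C e" "f \<in> Arr C" "Dom C f = Cod C e"
  shows "f = g \<cdot> Inv C e"
  using assms invertible_arr[OF assms(2)] by (metis Comp_Id_right Comp_assoc_arr Inv_arr)

end

section \<open>Calculus in monoidal categories: products of arrows and naturality of the structure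
  maps\<close>

context monoidal_category
begin

lemma Unit_Obj [simp]: "UnitO C \<in> Obj C"
  by (rule Unit_obj)

lemma Ten_Obj [simp]: "a \<in> Obj C \<Longrightarrow> b \<in> Obj C \<Longrightarrow> a \<otimes> b \<in> Obj C"
  by (rule Ten_obj)

lemma Ten_arr [simp]:
  assumes "f \<in> Arr C" "g \<in> Arr C"
  shows "f \<odot> g \<in> Arr C" "Dom C (f \<odot> g) = Dom C f \<otimes> Dom C g" "Cod C (f \<odot> g) = Cod C f \<otimes> Cod C g"
  using Ten_hom[of f "Dom C f" "Cod C f" g "Dom C g" "Cod C g"] assms by (auto simp: hom_def)

lemma Ten_Id' [simp]: "a \<in> Obj C \<Longrightarrow> b \<in> Obj C \<Longrightarrow> Id C a \<odot> Id C b = Id C (a \<otimes> b)"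
  by (rule Ten_Id)

lemma Comp_Ten:
  "\<lbrakk>f \<in> Arr C; f' \<in> Arr C; g \<in> Arr C; g' \<in> Arr C; Cod C f = Dom C f'; Cod C g = Dom C g'\<rbrakk> \<Longrightarrow>
    (f' \<odot> g') \<cdot> (f \<odot> g) = (f' \<cdot> f) \<odot> (g' \<cdot> g)"
  by (rule Ten_Comp[symmetric]) (auto simp: hom_def)

lemma Comp_Ten':
  "\<lbrakk>f \<in> Arr C; f' \<in> Arr C; g \<in> Arr C; g' \<in> Arr C; Cod C f = Dom C f'; Cod C g = Dom C g';
    x \<in> Arr C; Cod C x = Dom C f \<otimes> Dom C g\<rbrakk> \<Longrightarrow>
    (f' \<odot> g') \<cdot> ((f \<odot> g) \<cdot> x) = ((f' \<cdot> f) \<odot> (g' \<cdot> g)) \<cdot> x"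
  by (rule Comp_rewrite) (auto simp: Comp_Ten)

lemma inverse_arrows_Ten:
  assumes "invertible C f" "invertible C g"
  shows "inverse_arrows C (f \<odot> g) (Inv C f \<odot> Inv C g)"
  using assms invertible_arr[OF assms(1)] invertible_arr[OF assms(2)]
  by (auto simp: inverse_arrows_def hom_def Comp_Ten)

lemma invertible_Ten [simp]:
  "invertible C f \<Longrightarrow> invertible C g \<Longrightarrow> invertible C (f \<odot> g)"
  using inverse_arrows_Ten invertible_def by metis

lemma Inv_Ten: "invertible C f \<Longrightarrow> invertible C g \<Longrightarrow> Inv C (f \<odot> g) = Inv C f \<odot> Inv C g"
  by (simp add: inverse_arrows_Ten Inv_eqI)

lemma Assoc_arr [simp]:
  assumes "a \<in> Obj C" "b \<in> Obj C" "c \<in> Obj C"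
  shows "invertible C (Assoc C a b c)" "Assoc C a b c \<in> Arr C"
    "Dom C (Assoc C a b c) = (a \<otimes> b) \<otimes> c" "Cod C (Assoc C a b c) = a \<otimes> (b \<otimes> c)"
  using Assoc_iso[OF assms] by (auto simp: iso_iff invertible_arr)

lemma LUnit_arr [simp]:
  assumes "a \<in> Obj C"
  shows "invertible C (LUnit C a)" "LUnit C a \<in> Arr C"
    "Dom C (LUnit C a) = UnitO C \<otimes> a" "Cod C (LUnit C a) = a"
  using LUnit_iso[OF assms] by (auto simp: iso_iff invertible_arr)

lemma RUnit_arr [simp]:
  assumes "a \<in> Obj C"
  shows "invertible C (RUnit C a)" "RUnit C a \<in> Arr C"
    "Dom C (RUnit C a) = a \<otimes> UnitO C" "Cod C (RUnit C a) = a"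
  using RUnit_iso[OF assms] by (auto simp: iso_iff invertible_arr)

lemma Assoc_nat:
  "\<lbrakk>f \<in> Arr C; g \<in> Arr C; h \<in> Arr C; Cod C f = a; Cod C g = b; Cod C h = c\<rbrakk> \<Longrightarrow>
    Assoc C a b c \<cdot> ((f \<odot> g) \<odot> h) = (f \<odot> (g \<odot> h)) \<cdot> Assoc C (Dom C f) (Dom C g) (Dom C h)"
  by (rule Assoc_natural) (auto simp: hom_def)

lemma Assoc_nat':
  "\<lbrakk>f \<in> Arr C; g \<in> Arr C; h \<in> Arr C; Cod C f = a; Cod C g = b; Cod C h = c;
    x \<in> Arr C; Cod C x = (Dom C f \<otimes> Dom C g) \<otimes> Dom C h\<rbrakk> \<Longrightarrow>
    Assoc C a b c \<cdot> (((f \<odot> g) \<odot> h) \<cdot> x) =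
    (f \<odot> (g \<odot> h)) \<cdot> (Assoc C (Dom C f) (Dom C g) (Dom C h) \<cdot> x)"
  by (rule Comp_rewrite2) (auto simp: Assoc_nat)

lemma Inv_Assoc_nat:
  assumes "f \<in> Arr C" "g \<in> Arr C" "h \<in> Arr C" "Cod C f = a" "Cod C g = b" "Cod C h = c"
  shows "Inv C (Assoc C a b c) \<cdot> (f \<odot> (g \<odot> h)) =
    ((f \<odot> g) \<odot> h) \<cdot> Inv C (Assoc C (Dom C f) (Dom C g) (Dom C h))"
  by (rule cancel_left[of "Assoc C a b c"]) (use assms in \<open>auto simp: Assoc_nat'\<close>)

lemma Inv_Assoc_nat':
  "\<lbrakk>f \<in> Arr C; g \<in> Arr C; h \<in> Arr C; Cod C f = a; Cod C g = b; Cod C h = c;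
    x \<in> Arr C; Cod C x = Dom C f \<otimes> (Dom C g \<otimes> Dom C h)\<rbrakk> \<Longrightarrow>
    Inv C (Assoc C a b c) \<cdot> ((f \<odot> (g \<odot> h)) \<cdot> x) =
    ((f \<odot> g) \<odot> h) \<cdot> (Inv C (Assoc C (Dom C f) (Dom C g) (Dom C h)) \<cdot> x)"
  by (rule Comp_rewrite2) (auto simp: Inv_Assoc_nat)

lemma LUnit_nat:
  "f \<in> Arr C \<Longrightarrow> Cod C f = b \<Longrightarrow> LUnit C b \<cdot> (Id C (UnitO C) \<odot> f) = f \<cdot> LUnit C (Dom C f)"
  by (rule LUnit_natural) (auto simp: hom_def)

lemma RUnit_nat:
  "f \<in> Arr C \<Longrightarrow> Cod C f = b \<Longrightarrow> RUnit C b \<cdot> (f \<odot> Id C (UnitO C)) = f \<cdot> RUnit C (Dom C f)"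
  by (rule RUnit_natural) (auto simp: hom_def)

text \<open>Tensoring with the unit is naturally isomorphic to the identity functor, hence faithful.
  Unit identities may thus be checked after adding a unit factor, where pentagon and triangle
  apply.\<close>

lemma Unit_Ten_faithful:
  assumes "Id C (UnitO C) \<odot> f = Id C (UnitO C) \<odot> g"
    "f \<in> Arr C" "g \<in> Arr C" "Dom C f = Dom C g" "Cod C f = Cod C g"
  shows "f = g"
proof -
  have "f \<cdot> LUnit C (Dom C g) = g \<cdot> LUnit C (Dom C g)"
    using LUnit_nat[of f] LUnit_nat[of g] assms by simp
  then show ?thesis
    by (rule cancel_right) (use assms in auto)
qed

lemma Ten_Unit_faithful:
  assumes "f \<odot> Id C (UnitO C) = g \<odot> Id C (UnitO C)"
    "f \<in> Arr C" "g \<in> Arr C" "Dom C f = Dom C g" "Cod C f = Cod C g"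
  shows "f = g"
proof -
  have "f \<cdot> RUnit C (Dom C g) = g \<cdot> RUnit C (Dom C g)"
    using RUnit_nat[of f] RUnit_nat[of g] assms by simp
  then show ?thesis
    by (rule cancel_right) (use assms in auto)
qed

end

section \<open>Coherence of rebracketing\<close>

context monoidal_category
begin

text \<open>Kelly's derivation from pentagon and triangle: tensor both sides with a further unit on
  the left and precompose with the invertible right-hand part of the pentagon for two units,
  \<open>x\<close> and \<open>y\<close>.\<close>

lemma LUnit_Ten:
  assumes [simp]: "x \<in> Obj C" "y \<in> Obj C"
  shows "LUnit C (x \<otimes> y) \<cdot> Assoc C (UnitO C) x y = LUnit C x \<odot> Id C y"
proof (rule Unit_Ten_faithful)
  let ?I = "UnitO C"
  have "(Id C ?I \<odot> (LUnit C (x \<otimes> y) \<cdot> Assoc C ?I x y)) \<cdot>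
          (Assoc C ?I (?I \<otimes> x) y \<cdot> (Assoc C ?I ?I x \<odot> Id C y)) =
        (Id C ?I \<odot> LUnit C (x \<otimes> y)) \<cdot> (Id C ?I \<odot> Assoc C ?I x y) \<cdot>
          (Assoc C ?I (?I \<otimes> x) y \<cdot> (Assoc C ?I ?I x \<odot> Id C y))"
    by (simp add: Comp_Ten')
  also have "\<dots> = (Id C ?I \<odot> LUnit C (x \<otimes> y)) \<cdot>
      Assoc C ?I ?I (x \<otimes> y) \<cdot> Assoc C (?I \<otimes> ?I) x y"
    by (simp add: pentagon)
  also have "\<dots> = (RUnit C ?I \<odot> Id C (x \<otimes> y)) \<cdot> Assoc C (?I \<otimes> ?I) x y"
    by (rule Comp_rewrite) (simp_all add: triangle)
  also have "\<dots> = Assoc C ?I x y \<cdot> ((RUnit C ?I \<odot> Id C x) \<odot> Id C y)"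
    by (simp add: Assoc_nat)
  also have "\<dots> = Assoc C ?I x y \<cdot> ((Id C ?I \<odot> LUnit C x) \<odot> Id C y) \<cdot> (Assoc C ?I ?I x \<odot> Id C y)"
    by (simp add: Comp_Ten triangle)
  also have "\<dots> = (Id C ?I \<odot> (LUnit C x \<odot> Id C y)) \<cdot>
          (Assoc C ?I (?I \<otimes> x) y \<cdot> (Assoc C ?I ?I x \<odot> Id C y))"
    by (simp add: Assoc_nat')
  finally show "Id C ?I \<odot> (LUnit C (x \<otimes> y) \<cdot> Assoc C ?I x y) = Id C ?I \<odot> (LUnit C x \<odot> Id C y)"
    by (rule cancel_right) simp_all
qed simp_all

text \<open>Mirror image of \<open>LUnit_Ten\<close>: a unit is added on the right, the pentagon is
  taken for \<open>x\<close>, \<open>y\<close> and two units, and an associator is cancelled on the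
  left.\<close>

lemma RUnit_Ten:
  assumes [simp]: "x \<in> Obj C" "y \<in> Obj C"
  shows "(Id C x \<odot> RUnit C y) \<cdot> Assoc C x y (UnitO C) = RUnit C (x \<otimes> y)"
proof (rule Ten_Unit_faithful)
  let ?I = "UnitO C"
  have "Assoc C x y ?I \<cdot> (((Id C x \<odot> RUnit C y) \<cdot> Assoc C x y ?I) \<odot> Id C ?I) =
        Assoc C x y ?I \<cdot> ((Id C x \<odot> RUnit C y) \<odot> Id C ?I) \<cdot> (Assoc C x y ?I \<odot> Id C ?I)"
    by (simp add: Comp_Ten)
  also have "\<dots> = (Id C x \<odot> (RUnit C y \<odot> Id C ?I)) \<cdot>
      Assoc C x (y \<otimes> ?I) ?I \<cdot> (Assoc C x y ?I \<odot> Id C ?I)"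
    by (simp add: Assoc_nat')
  also have "\<dots> = (Id C x \<odot> (Id C y \<odot> LUnit C ?I)) \<cdot> (Id C x \<odot> Assoc C y ?I ?I) \<cdot>
      Assoc C x (y \<otimes> ?I) ?I \<cdot> (Assoc C x y ?I \<odot> Id C ?I)"
    by (simp add: Comp_Ten' triangle)
  also have "\<dots> = (Id C x \<odot> (Id C y \<odot> LUnit C ?I)) \<cdot>
      Assoc C x y (?I \<otimes> ?I) \<cdot> Assoc C (x \<otimes> y) ?I ?I"
    by (simp add: pentagon)
  also have "\<dots> = Assoc C x y ?I \<cdot> ((Id C x \<odot> Id C y) \<odot> LUnit C ?I) \<cdot> Assoc C (x \<otimes> y) ?I ?I"
    by (simp add: Assoc_nat' del: Ten_Id')
  also have "\<dots> = Assoc C x y ?I \<cdot> (RUnit C (x \<otimes> y) \<odot> Id C ?I)"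
    by (simp add: triangle)
  finally show "((Id C x \<odot> RUnit C y) \<cdot> Assoc C x y ?I) \<odot> Id C ?I = RUnit C (x \<otimes> y) \<odot> Id C ?I"
    by (rule cancel_left) simp_all
qed simp_all

text \<open>Naturality of the left unitor at itself identifies two maps on a threefold product of
  units; \<open>LUnit_Ten\<close> and the triangle turn these into the two unitors. This makes
  \<open>rebracket_Nil_right\<close> uniform: for two empty lists the definition of
  \<open>rebracket\<close> yields \<open>LUnit\<close>.\<close>

lemma LUnit_Unit: "LUnit C (UnitO C) = RUnit C (UnitO C)"
proof (rule Ten_Unit_faithful)
  let ?I = "UnitO C"
  have "LUnit C ?I \<cdot> (Id C ?I \<odot> LUnit C ?I) = LUnit C ?I \<cdot> LUnit C (?I \<otimes> ?I)"
    by (simp add: LUnit_nat)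
  then have "Id C ?I \<odot> LUnit C ?I = LUnit C (?I \<otimes> ?I)"
    by (rule cancel_left) simp_all
  then show "LUnit C ?I \<odot> Id C ?I = RUnit C ?I \<odot> Id C ?I"
    by (simp add: LUnit_Ten[symmetric] triangle[symmetric])
qed simp_all

lemma tens_snoc: "as \<noteq> [] \<Longrightarrow> tens C (as @ [b]) = tens C as \<otimes> b"
  by (cases as) auto

lemma foldl_TenO_Obj: "a \<in> Obj C \<Longrightarrow> as \<in> lists (Obj C) \<Longrightarrow> foldl (TenO C) a as \<in> Obj C"
  by (induction as arbitrary: a) auto

lemma tens_Obj [simp]: "as \<in> lists (Obj C) \<Longrightarrow> tens C as \<in> Obj C"
  by (cases as) (auto simp: foldl_TenO_Obj)

lemma rebracket_Nil_left: "rebracket C [] bs = LUnit C (tens C bs)"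
  by (simp add: rebracket_def)

lemma rebracket_Nil_right: "rebracket C as [] = RUnit C (tens C as)"
  by (simp add: rebracket_def LUnit_Unit)

text \<open>For empty \<open>as\<close> the map is the left unitor from
  \<open>UnitO C \<otimes> b\<close> to \<open>b\<close> instead; this exception is behind the later
  case splits on empty lists.\<close>

lemma rebracket_single: "as \<noteq> [] \<Longrightarrow> rebracket C as [b] = Id C (tens C as \<otimes> b)"
  by (simp add: rebracket_def)

lemma rebracket_snoc:
  assumes "as \<noteq> []" "bs \<noteq> []"
  shows "rebracket C as (bs @ [b]) =
    (rebracket C as bs \<odot> Id C b) \<cdot> Inv C (Assoc C (tens C as) (tens C bs) b)"
proof -
  obtain c cs where "rev bs = c # cs"
    using assms(2) by (cases "rev bs") auto
  then show ?thesis
    using assms by (simp add: rebracket_def)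
qed

lemma rebracket_arr [simp]:
  assumes "as \<in> lists (Obj C)" "bs \<in> lists (Obj C)"
  shows "invertible C (rebracket C as bs)" "Dom C (rebracket C as bs) = tens C as \<otimes> tens C bs"
    "Cod C (rebracket C as bs) = tens C (as @ bs)"
proof -
  have "invertible C (rebracket C as bs) \<and> Dom C (rebracket C as bs) = tens C as \<otimes> tens C bs \<and>
    Cod C (rebracket C as bs) = tens C (as @ bs)"
  proof (cases "as = []")
    case True
    then show ?thesis using assms by (simp add: rebracket_Nil_left)
  next
    case False
    show ?thesis using assms(2)
    proof (induction bs rule: rev_induct)
      case Nil
      then show ?case using assms False by (simp add: rebracket_Nil_right)
    next
      case (snoc b bs)
      then show ?case
        using assms False
        by (cases "bs = []")
          (auto simp: rebracket_single rebracket_snoc tens_snoc invertible_arr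
            tens_snoc[of "as @ bs" for bs, simplified])
    qed
  qed
  then show "invertible C (rebracket C as bs)" "Dom C (rebracket C as bs) = tens C as \<otimes> tens C bs"
    "Cod C (rebracket C as bs) = tens C (as @ bs)"
    by auto
qed

lemma rebracket_Arr [simp]:
  "as \<in> lists (Obj C) \<Longrightarrow> bs \<in> lists (Obj C) \<Longrightarrow> rebracket C as bs \<in> Arr C"
  by (simp add: invertible_arr)

text \<open>Cocycle identity for rebracketing. For empty \<open>as\<close> it is
  \<open>LUnit_Ten\<close> with naturality of the unitor, for empty \<open>bs\<close> the triangle.
  Otherwise \<open>cs\<close> is built up from the right, as left bracketing demands: the start is
  \<open>RUnit_Ten\<close>, and each further factor costs one pentagon.\<close>

lemma rebracket_assoc:
  assumes as: "as \<in> lists (Obj C)" and bs: "bs \<in> lists (Obj C)" and cs: "cs \<in> lists (Obj C)"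
  shows "rebracket C (as @ bs) cs \<cdot> (rebracket C as bs \<odot> Id C (tens C cs)) =
    rebracket C as (bs @ cs) \<cdot> (Id C (tens C as) \<odot> rebracket C bs cs) \<cdot>
      Assoc C (tens C as) (tens C bs) (tens C cs)"
proof -
  note [simp] = as bs
  consider "as = []" | "as \<noteq> []" "bs = []" | "as \<noteq> []" "bs \<noteq> []" by blast
  then show ?thesis
  proof cases
    case 1
    have "LUnit C (tens C (bs @ cs)) \<cdot> (Id C (UnitO C) \<odot> rebracket C bs cs) \<cdot>
        Assoc C (UnitO C) (tens C bs) (tens C cs) =
      rebracket C bs cs \<cdot> LUnit C (tens C bs \<otimes> tens C cs) \<cdot>
        Assoc C (UnitO C) (tens C bs) (tens C cs)"
      using cs by (intro Comp_rewrite2) (auto simp: LUnit_nat)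
    then show ?thesis
      using 1 cs by (simp add: rebracket_Nil_left LUnit_Ten)
  next
    case 2
    then show ?thesis
      using cs by (simp add: rebracket_Nil_left rebracket_Nil_right triangle)
  next
    case 3
    note ne [simp] = 3
    show ?thesis using cs
    proof (induction cs rule: rev_induct)
      case Nil
      have "rebracket C as bs \<cdot> (Id C (tens C as) \<odot> RUnit C (tens C bs)) \<cdot>
          Assoc C (tens C as) (tens C bs) (UnitO C) =
        rebracket C as bs \<cdot> RUnit C (tens C as \<otimes> tens C bs)"
        by (simp add: RUnit_Ten)
      then show ?case
        by (simp add: rebracket_Nil_right RUnit_nat)
    next
      case (snoc c cs)
      then have [simp]: "cs \<in> lists (Obj C)" "c \<in> Obj C" by auto
      let ?A = "tens C as" and ?B = "tens C bs" and ?C = "tens C cs"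
      show ?case
      proof (cases "cs = []")
        case True
        then show ?thesis
          by (simp add: rebracket_single rebracket_snoc tens_snoc Comp_assoc_arr)
      next
        case False
        \<comment> \<open>The pentagon with two associators moved across as inverses, the form in
          which \<open>rebracket_snoc\<close> produces them.\<close>
        have P: "Assoc C ?A (?B \<otimes> ?C) c \<cdot> (Assoc C ?A ?B ?C \<odot> Id C c) \<cdot> Inv C (Assoc C (?A \<otimes> ?B) ?C c) =
          (Id C ?A \<odot> Inv C (Assoc C ?B ?C c)) \<cdot> Assoc C ?A ?B (?C \<otimes> c)"
        proof (rule cancel_left)
          have "(Id C ?A \<odot> Assoc C ?B ?C c) \<cdot> Assoc C ?A (?B \<otimes> ?C) c \<cdot> (Assoc C ?A ?B ?C \<odot> Id C c) \<cdot>
              Inv C (Assoc C (?A \<otimes> ?B) ?C c) =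
            (Assoc C ?A ?B (?C \<otimes> c) \<cdot> Assoc C (?A \<otimes> ?B) ?C c) \<cdot> Inv C (Assoc C (?A \<otimes> ?B) ?C c)"
            by (simp add: pentagon Comp_assoc_arr)
          also have "\<dots> = Assoc C ?A ?B (?C \<otimes> c)"
            by (simp add: Comp_assoc_arr)
          finally show "(Id C ?A \<odot> Assoc C ?B ?C c) \<cdot> Assoc C ?A (?B \<otimes> ?C) c \<cdot>
              (Assoc C ?A ?B ?C \<odot> Id C c) \<cdot> Inv C (Assoc C (?A \<otimes> ?B) ?C c) =
            (Id C ?A \<odot> Assoc C ?B ?C c) \<cdot> (Id C ?A \<odot> Inv C (Assoc C ?B ?C c)) \<cdot> Assoc C ?A ?B (?C \<otimes> c)"
            by (simp add: Comp_Ten')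
        qed simp_all
        have "rebracket C (as @ bs) (cs @ [c]) \<cdot> (rebracket C as bs \<odot> Id C (?C \<otimes> c)) =
          (rebracket C (as @ bs) cs \<odot> Id C c) \<cdot> (Inv C (Assoc C (tens C (as @ bs)) ?C c) \<cdot>
            (rebracket C as bs \<odot> (Id C ?C \<odot> Id C c)))"
          using False by (simp add: rebracket_snoc Comp_assoc_arr)
        also have "\<dots> = ((rebracket C (as @ bs) cs \<cdot> (rebracket C as bs \<odot> Id C ?C)) \<odot> Id C c) \<cdot>
            Inv C (Assoc C (?A \<otimes> ?B) ?C c)"
          by (simp add: Inv_Assoc_nat Comp_Ten' del: Ten_Id')
        also have "\<dots> = ((rebracket C as (bs @ cs) \<cdot> (Id C ?A \<odot> rebracket C bs cs)) \<odot> Id C c) \<cdot>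
          (Assoc C ?A ?B ?C \<odot> Id C c) \<cdot> Inv C (Assoc C (?A \<otimes> ?B) ?C c)"
          using snoc.IH by (simp add: Comp_Ten' Comp_assoc_arr)
        also have "\<dots> = ((rebracket C as (bs @ cs) \<cdot> (Id C ?A \<odot> rebracket C bs cs)) \<odot> Id C c) \<cdot>
          Inv C (Assoc C ?A (?B \<otimes> ?C) c) \<cdot>
          (Id C ?A \<odot> Inv C (Assoc C ?B ?C c)) \<cdot> Assoc C ?A ?B (?C \<otimes> c)"
          by (simp flip: P)
        also have "\<dots> = (rebracket C as (bs @ cs) \<odot> Id C c) \<cdot> ((Id C ?A \<odot> rebracket C bs cs) \<odot> Id C c) \<cdot>
          Inv C (Assoc C ?A (?B \<otimes> ?C) c) \<cdot>
          (Id C ?A \<odot> Inv C (Assoc C ?B ?C c)) \<cdot> Assoc C ?A ?B (?C \<otimes> c)"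
          by (simp add: Comp_Ten')
        also have "\<dots> = (rebracket C as (bs @ cs) \<odot> Id C c) \<cdot>
          Inv C (Assoc C ?A (tens C (bs @ cs)) c) \<cdot> (Id C ?A \<odot> (rebracket C bs cs \<odot> Id C c)) \<cdot>
          (Id C ?A \<odot> Inv C (Assoc C ?B ?C c)) \<cdot> Assoc C ?A ?B (?C \<otimes> c)"
          by (simp add: Inv_Assoc_nat')
        also have "\<dots> = rebracket C as (bs @ cs @ [c]) \<cdot> (Id C ?A \<odot> rebracket C bs (cs @ [c])) \<cdot>
          Assoc C ?A ?B (?C \<otimes> c)"
          using False rebracket_snoc[of as "bs @ cs" c]
          by (simp add: Comp_Ten' rebracket_snoc Comp_assoc_arr)
        finally show ?thesis
          using False by (simp add: tens_snoc)
      qed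
    qed
  qed
qed

end

section \<open>The interchange isomorphism\<close>

context symmetric_monoidal_category
begin

lemma Braid_arr [simp]:
  assumes "a \<in> Obj C" "b \<in> Obj C"
  shows "Braid C a b \<in> Arr C" "Dom C (Braid C a b) = a \<otimes> b" "Cod C (Braid C a b) = b \<otimes> a"
  using Braid_hom[OF assms] by (auto simp: hom_def)

lemma invertible_Braid [simp]: "a \<in> Obj C \<Longrightarrow> b \<in> Obj C \<Longrightarrow> invertible C (Braid C a b)"
  unfolding invertible_def inverse_arrows_def
  by (rule exI[of _ "Braid C b a"]) (simp add: hom_def Braid_Braid)

lemma Braid_nat:
  "\<lbrakk>f \<in> Arr C; g \<in> Arr C; Cod C f = a; Cod C g = b\<rbrakk> \<Longrightarrow>
    Braid C a b \<cdot> (f \<odot> g) = (g \<odot> f) \<cdot> Braid C (Dom C f) (Dom C g)"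
  by (rule Braid_natural) (auto simp: hom_def)

lemma interchange_arr [simp]:
  assumes "a \<in> Obj C" "b \<in> Obj C" "c \<in> Obj C" "d \<in> Obj C"
  shows "invertible C (interchange C a b c d)" "interchange C a b c d \<in> Arr C"
    "Dom C (interchange C a b c d) = (a \<otimes> b) \<otimes> (c \<otimes> d)"
    "Cod C (interchange C a b c d) = (a \<otimes> c) \<otimes> (b \<otimes> d)"
  using assms by (simp_all add: interchange_def)

lemma interchange_natural:
  assumes "f \<in> Arr C" "g \<in> Arr C" "h \<in> Arr C" "k \<in> Arr C"
    "Cod C f = a" "Cod C g = b" "Cod C h = c" "Cod C k = d"
  shows "interchange C a b c d \<cdot> ((f \<odot> g) \<odot> (h \<odot> k)) =
    ((f \<odot> h) \<odot> (g \<odot> k)) \<cdot> interchange C (Dom C f) (Dom C g) (Dom C h) (Dom C k)"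
proof -
  let ?f = "Dom C f" and ?g = "Dom C g" and ?h = "Dom C h" and ?k = "Dom C k"
  note [simp] = assms(1-4) assms(5-)[symmetric]
  \<comment> \<open>The block that swaps the middle factors is kept opaque: its naturality is proved
    once, and the outer associators move past it as past any arrow.\<close>
  define m where "m = Assoc C c b d \<cdot> (Braid C b c \<odot> Id C d) \<cdot> Inv C (Assoc C b c d)"
  define m' where "m' = Assoc C ?h ?g ?k \<cdot> (Braid C ?g ?h \<odot> Id C ?k) \<cdot> Inv C (Assoc C ?g ?h ?k)"
  have eq: "interchange C a b c d = Inv C (Assoc C a c (b \<otimes> d)) \<cdot> (Id C a \<odot> m) \<cdot> Assoc C a b (c \<otimes> d)"
    "interchange C ?f ?g ?h ?k =
      Inv C (Assoc C ?f ?h (?g \<otimes> ?k)) \<cdot> (Id C ?f \<odot> m') \<cdot> Assoc C ?f ?g (?h \<otimes> ?k)"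
    by (simp_all only: interchange_def m_def m'_def)
  have m: "m \<in> Arr C" "Dom C m = b \<otimes> (c \<otimes> d)" "Cod C m = c \<otimes> (b \<otimes> d)"
    "m' \<in> Arr C" "Dom C m' = ?g \<otimes> (?h \<otimes> ?k)" "Cod C m' = ?h \<otimes> (?g \<otimes> ?k)"
    by (simp_all add: m_def m'_def)
  have "m \<cdot> (g \<odot> (h \<odot> k)) = Assoc C c b d \<cdot> ((Braid C b c \<cdot> (g \<odot> h)) \<odot> k) \<cdot> Inv C (Assoc C ?g ?h ?k)"
    by (simp add: m_def Comp_assoc_arr Inv_Assoc_nat Comp_Ten')
  also have "\<dots> = Assoc C c b d \<cdot> ((h \<odot> g) \<odot> k) \<cdot> (Braid C ?g ?h \<odot> Id C ?k) \<cdot> Inv C (Assoc C ?g ?h ?k)"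
    by (simp add: Braid_nat Comp_Ten')
  also have "\<dots> = (h \<odot> (g \<odot> k)) \<cdot> m'"
    by (simp add: m'_def Assoc_nat')
  finally have middle: "m \<cdot> (g \<odot> (h \<odot> k)) = (h \<odot> (g \<odot> k)) \<cdot> m'" .
  have "interchange C a b c d \<cdot> ((f \<odot> g) \<odot> (h \<odot> k)) =
    Inv C (Assoc C a c (b \<otimes> d)) \<cdot> (f \<odot> (m \<cdot> (g \<odot> (h \<odot> k)))) \<cdot> Assoc C ?f ?g (?h \<otimes> ?k)"
    unfolding eq using m by (simp add: Comp_assoc_arr Assoc_nat Comp_Ten')
  also have "\<dots> = Inv C (Assoc C a c (b \<otimes> d)) \<cdot> (f \<odot> (h \<odot> (g \<odot> k))) \<cdot> (Id C ?f \<odot> m') \<cdot>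
      Assoc C ?f ?g (?h \<otimes> ?k)"
    using m unfolding middle by (simp add: Comp_Ten')
  also have "\<dots> = ((f \<odot> h) \<odot> (g \<odot> k)) \<cdot> interchange C ?f ?g ?h ?k"
    unfolding eq using m by (simp add: Comp_assoc_arr Inv_Assoc_nat')
  finally show ?thesis .
qed

lemma pow_0 [simp]: "pow C a 0 = UnitO C"
  by (simp add: pow_def)

lemma pow_1 [simp]: "pow C a (Suc 0) = a"
  by (simp add: pow_def)

lemma pow_Suc_Suc [simp]: "pow C a (Suc (Suc n)) = pow C a (Suc n) \<otimes> a"
  using tens_snoc[of "replicate (Suc n) a" a] by (simp add: pow_def replicate_append_same)

lemma pow_Obj [simp]: "a \<in> Obj C \<Longrightarrow> pow C a n \<in> Obj C"
  by (auto simp: pow_def intro!: tens_Obj)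

lemma shuffle_arr:
  assumes "a \<in> Obj C" "b \<in> Obj C"
  shows "invertible C (shuffle C a b n) \<and> shuffle C a b n \<in> Arr C \<and>
    Dom C (shuffle C a b n) = pow C a n \<otimes> pow C b n \<and>
    Cod C (shuffle C a b n) = pow C (a \<otimes> b) n"
  using assms by (induction n rule: induct_nat_012) auto

lemmas shuffle_simps [simp] =
  shuffle_arr[THEN conjunct1]
  shuffle_arr[THEN conjunct2, THEN conjunct1]
  shuffle_arr[THEN conjunct2, THEN conjunct2, THEN conjunct1]
  shuffle_arr[THEN conjunct2, THEN conjunct2, THEN conjunct2]

lemma unit_shuffle_arr:
  "invertible C (unit_shuffle C n) \<and> unit_shuffle C n \<in> Arr C \<and>
    Dom C (unit_shuffle C n) = UnitO C \<and> Cod C (unit_shuffle C n) = pow C (UnitO C) n"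
  by (induction n rule: induct_nat_012) (auto simp: invertible_arr)

lemmas unit_shuffle_simps [simp] =
  unit_shuffle_arr[THEN conjunct1]
  unit_shuffle_arr[THEN conjunct2, THEN conjunct1]
  unit_shuffle_arr[THEN conjunct2, THEN conjunct2, THEN conjunct1]
  unit_shuffle_arr[THEN conjunct2, THEN conjunct2, THEN conjunct2]

end

section \<open>Interchange in strict categories: the tensor product as a symmetric monoidal
  functor\<close>

context symmetric_strict_monoidal_category
begin

lemma strict_obj [simp]:
  "\<lbrakk>a \<in> Obj C; b \<in> Obj C; c \<in> Obj C\<rbrakk> \<Longrightarrow> (a \<otimes> b) \<otimes> c = a \<otimes> (b \<otimes> c)"
  "a \<in> Obj C \<Longrightarrow> UnitO C \<otimes> a = a"
  "a \<in> Obj C \<Longrightarrow> a \<otimes> UnitO C = a"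
  by (fact strict_assoc strict_lunit strict_runit)+

lemma strict_structure [simp]:
  "\<lbrakk>a \<in> Obj C; b \<in> Obj C; c \<in> Obj C\<rbrakk> \<Longrightarrow> Assoc C a b c = Id C (a \<otimes> (b \<otimes> c))"
  "a \<in> Obj C \<Longrightarrow> LUnit C a = Id C a"
  "a \<in> Obj C \<Longrightarrow> RUnit C a = Id C a"
  by (simp_all add: Assoc_Id LUnit_Id RUnit_Id)

lemma Ten_assoc: "\<lbrakk>f \<in> Arr C; g \<in> Arr C; h \<in> Arr C\<rbrakk> \<Longrightarrow> (f \<odot> g) \<odot> h = f \<odot> (g \<odot> h)"
  using Assoc_nat[of f g h, OF _ _ _ refl refl refl] by simp

lemma Ten_Unit [simp]:
  "f \<in> Arr C \<Longrightarrow> Id C (UnitO C) \<odot> f = f"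
  "f \<in> Arr C \<Longrightarrow> f \<odot> Id C (UnitO C) = f"
  using LUnit_nat[OF _ refl, of f] RUnit_nat[OF _ refl, of f] by simp_all

lemma Braid_Ten_right:
  assumes [simp]: "a \<in> Obj C" "b \<in> Obj C" "c \<in> Obj C"
  shows "Braid C a (b \<otimes> c) = (Id C b \<odot> Braid C a c) \<cdot> (Braid C a b \<odot> Id C c)"
  using hexagon[of a b c] by simp

text \<open>The hexagon with two unit factors makes this braiding idempotent, and an invertible
  idempotent is an identity.\<close>

lemma Braid_Unit_right [simp]:
  assumes [simp]: "a \<in> Obj C"
  shows "Braid C a (UnitO C) = Id C a"
proof -
  have "Braid C a (UnitO C) \<cdot> Braid C a (UnitO C) = Braid C a (UnitO C) \<cdot> Id C a"
    using Braid_Ten_right[of a "UnitO C" "UnitO C"] by simp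
  then show ?thesis
    by (rule cancel_left) simp_all
qed

lemma Braid_Unit_left [simp]:
  assumes [simp]: "a \<in> Obj C"
  shows "Braid C (UnitO C) a = Id C a"
  using Braid_Braid[of a "UnitO C"] by simp

text \<open>The second hexagon is the inverse of the first, by symmetry: composed with the opposite
  braiding, which expands by \<open>Braid_Ten_right\<close>, the braidings cancel in pairs.\<close>

lemma Braid_Ten_left:
  assumes [simp]: "a \<in> Obj C" "b \<in> Obj C" "c \<in> Obj C"
  shows "Braid C (a \<otimes> b) c = (Braid C a c \<odot> Id C b) \<cdot> (Id C a \<odot> Braid C b c)"
proof (rule cancel_right)
  have "((Braid C a c \<odot> Id C b) \<cdot> (Id C a \<odot> Braid C b c)) \<cdot> Braid C c (a \<otimes> b) =
    (Braid C a c \<odot> Id C b) \<cdot> (Id C a \<odot> Braid C b c) \<cdot> (Id C a \<odot> Braid C c b) \<cdot> (Braid C c a \<odot> Id C b)"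
    by (simp add: Braid_Ten_right Comp_assoc_arr)
  also have "\<dots> = Id C (c \<otimes> (a \<otimes> b))"
    by (simp add: Comp_Ten' Comp_Ten Braid_Braid)
  finally show "Braid C (a \<otimes> b) c \<cdot> Braid C c (a \<otimes> b) =
    ((Braid C a c \<odot> Id C b) \<cdot> (Id C a \<odot> Braid C b c)) \<cdot> Braid C c (a \<otimes> b)"
    by (simp add: Braid_Braid)
qed simp_all

lemma interchange_strict:
  "\<lbrakk>a \<in> Obj C; b \<in> Obj C; c \<in> Obj C; d \<in> Obj C\<rbrakk> \<Longrightarrow>
    interchange C a b c d = Id C a \<odot> (Braid C b c \<odot> Id C d)"
  by (simp add: interchange_def)

lemma interchange_natural_strict:
  "\<lbrakk>f \<in> Arr C; g \<in> Arr C; h \<in> Arr C; k \<in> Arr C;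
    Cod C f = a; Cod C g = b; Cod C h = c; Cod C k = d\<rbrakk> \<Longrightarrow>
    interchange C a b c d \<cdot> (f \<odot> (g \<odot> (h \<odot> k))) =
    (f \<odot> (h \<odot> (g \<odot> k))) \<cdot> interchange C (Dom C f) (Dom C g) (Dom C h) (Dom C k)"
  using interchange_natural[of f g h k a b c d] by (simp add: Ten_assoc)

text \<open>Both sides first braid \<open>a''\<close> with \<open>b\<close>; they differ in the order of the commuting braidings of
  \<open>a'\<close> with \<open>b\<close> and of \<open>a''\<close> with \<open>b'\<close>.\<close>

lemma interchange_assoc:
  assumes [simp]: "a \<in> Obj C" "a' \<in> Obj C" "a'' \<in> Obj C" "b \<in> Obj C" "b' \<in> Obj C" "b'' \<in> Obj C"
  shows "(interchange C a a' b b' \<odot> Id C (a'' \<otimes> b'')) \<cdot> interchange C (a \<otimes> a') a'' (b \<otimes> b') b'' =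
    (Id C (a \<otimes> b) \<odot> interchange C a' a'' b' b'') \<cdot> interchange C a (a' \<otimes> a'') b (b' \<otimes> b'')"
proof -
  have 1: "(Braid C a' b \<odot> Id C (b' \<otimes> a'')) \<cdot> (Id C a' \<odot> Braid C a'' (b \<otimes> b')) =
    (Id C (b \<otimes> a') \<odot> Braid C a'' b') \<cdot> (Braid C (a' \<otimes> a'') b \<odot> Id C b')"
  proof -
    have "(Braid C a' b \<odot> Id C (b' \<otimes> a'')) \<cdot> (Id C a' \<odot> Braid C a'' (b \<otimes> b')) =
      (Braid C a' b \<odot> Id C (b' \<otimes> a'')) \<cdot> (Id C a' \<odot> (Id C b \<odot> Braid C a'' b')) \<cdot>
        (Id C a' \<odot> (Braid C a'' b \<odot> Id C b'))"
      by (simp add: Braid_Ten_right Comp_Ten)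
    also have "\<dots> = ((Braid C a' b \<odot> Id C (b' \<otimes> a'')) \<cdot> (Id C (a' \<otimes> b) \<odot> Braid C a'' b')) \<cdot>
        (Id C a' \<odot> (Braid C a'' b \<odot> Id C b'))"
      by (simp add: Comp_assoc_arr flip: Ten_assoc)
    also have "\<dots> = (Braid C a' b \<odot> Braid C a'' b') \<cdot> (Id C a' \<odot> (Braid C a'' b \<odot> Id C b'))"
      by (simp add: Comp_Ten)
    also have "\<dots> = ((Id C (b \<otimes> a') \<odot> Braid C a'' b') \<cdot> (Braid C a' b \<odot> Id C (a'' \<otimes> b'))) \<cdot>
        (Id C a' \<odot> (Braid C a'' b \<odot> Id C b'))"
      by (simp add: Comp_Ten)
    also have "\<dots> = (Id C (b \<otimes> a') \<odot> Braid C a'' b') \<cdot> ((Braid C a' b \<odot> Id C a'') \<odot> Id C b') \<cdot>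
        ((Id C a' \<odot> Braid C a'' b) \<odot> Id C b')"
      by (simp add: Comp_assoc_arr Ten_assoc)
    also have "\<dots> = (Id C (b \<otimes> a') \<odot> Braid C a'' b') \<cdot> (Braid C (a' \<otimes> a'') b \<odot> Id C b')"
      by (simp add: Comp_Ten Braid_Ten_left)
    finally show ?thesis .
  qed
  have "(interchange C a a' b b' \<odot> Id C (a'' \<otimes> b'')) \<cdot> interchange C (a \<otimes> a') a'' (b \<otimes> b') b'' =
    (Id C a \<odot> ((Braid C a' b \<odot> Id C (b' \<otimes> a'')) \<odot> Id C b'')) \<cdot>
    (Id C a \<odot> ((Id C a' \<odot> Braid C a'' (b \<otimes> b')) \<odot> Id C b''))"
    by (simp add: interchange_strict Ten_assoc flip: Ten_Id')
  also have "\<dots> = (Id C a \<odot> ((Id C (b \<otimes> a') \<odot> Braid C a'' b') \<odot> Id C b'')) \<cdot>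
      (Id C a \<odot> ((Braid C (a' \<otimes> a'') b \<odot> Id C b') \<odot> Id C b''))"
    by (simp add: Comp_Ten 1)
  also have "\<dots> = (Id C (a \<otimes> b) \<odot> interchange C a' a'' b' b'') \<cdot> interchange C a (a' \<otimes> a'') b (b' \<otimes> b'')"
    by (simp add: interchange_strict Ten_assoc flip: Ten_Id')
  finally show ?thesis .
qed

lemma interchange_interchange:
  "\<lbrakk>a \<in> Obj C; b \<in> Obj C; c \<in> Obj C; d \<in> Obj C\<rbrakk> \<Longrightarrow>
    interchange C a c b d \<cdot> interchange C a b c d = Id C (a \<otimes> (b \<otimes> (c \<otimes> d)))"
  by (simp add: interchange_strict Comp_Ten Braid_Braid)

lemma Inv_interchange:
  "\<lbrakk>a \<in> Obj C; b \<in> Obj C; c \<in> Obj C; d \<in> Obj C\<rbrakk> \<Longrightarrow>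
    Inv C (interchange C a b c d) = interchange C a c b d"
  by (rule Inv_eqI) (simp add: inverse_arrows_def in_hom_iff interchange_interchange)

text \<open>Inverse of \<open>interchange_assoc\<close>, since swapping the middle arguments inverts
  an interchange. In this direction it is the associativity axiom for \<open>\<otimes>\<close> as a
  monoidal functor of two variables with strongator \<open>interchange\<close>. The uninverted form
  serves sums of exponents in \<open>shuffle_add\<close>, this one triple products in
  \<open>shuffle_assoc\<close>.\<close>

lemma interchange_assoc':
  assumes [simp]: "a \<in> Obj C" "a' \<in> Obj C" "b \<in> Obj C" "b' \<in> Obj C" "c \<in> Obj C" "c' \<in> Obj C"
  shows "interchange C (a \<otimes> b) (a' \<otimes> b') c c' \<cdot> (interchange C a a' b b' \<odot> Id C (c \<otimes> c')) =
    interchange C a a' (b \<otimes> c) (b' \<otimes> c') \<cdot> (Id C (a \<otimes> a') \<odot> interchange C b b' c c')"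
proof -
  have "Inv C ((interchange C a b a' b' \<odot> Id C (c \<otimes> c')) \<cdot> interchange C (a \<otimes> b) c (a' \<otimes> b') c') =
    Inv C ((Id C (a \<otimes> a') \<odot> interchange C b c b' c') \<cdot> interchange C a (b \<otimes> c) a' (b' \<otimes> c'))"
    by (simp add: interchange_assoc)
  then show ?thesis
    by (simp add: Inv_Comp Inv_Ten Inv_interchange)
qed

text \<open>The block braiding is a composite of four elementary braidings. The first is an
  interchange that cancels against the given one, the last is the interchange on the right-hand
  side, and the two between act on disjoint factors. It is the symmetry axiom for
  \<open>\<otimes>\<close> as a functor of two variables.\<close>

lemma Braid_interchange:
  assumes [simp]: "a \<in> Obj C" "b \<in> Obj C" "c \<in> Obj C" "d \<in> Obj C"
  shows "Braid C (a \<otimes> c) (b \<otimes> d) \<cdot> interchange C a b c d =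
    interchange C b a d c \<cdot> (Braid C a b \<odot> Braid C c d)"
proof -
  have "Braid C (a \<otimes> c) (b \<otimes> d) =
    (Id C b \<odot> ((Braid C a d \<odot> Id C c) \<cdot> (Id C a \<odot> Braid C c d))) \<cdot>
    (((Braid C a b \<odot> Id C c) \<cdot> (Id C a \<odot> Braid C c b)) \<odot> Id C d)"
    by (simp add: Braid_Ten_right Braid_Ten_left)
  also have "\<dots> = (Id C b \<odot> (Braid C a d \<odot> Id C c)) \<cdot> (Id C b \<odot> (Id C a \<odot> Braid C c d)) \<cdot>
    ((Braid C a b \<odot> Id C c) \<odot> Id C d) \<cdot> ((Id C a \<odot> Braid C c b) \<odot> Id C d)"
    using Comp_Ten[of "Id C b" "Id C b" "Id C a \<odot> Braid C c d" "Braid C a d \<odot> Id C c"]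
      Comp_Ten[of "Id C a \<odot> Braid C c b" "Braid C a b \<odot> Id C c" "Id C d" "Id C d"]
    by (simp flip: Comp_assoc_arr)
  also have "\<dots> = interchange C b a d c \<cdot> (Id C (b \<otimes> a) \<odot> Braid C c d) \<cdot> (Braid C a b \<odot> Id C (c \<otimes> d)) \<cdot>
    interchange C a c b d"
    by (simp add: interchange_strict Ten_assoc flip: Ten_Id')
  also have "\<dots> = interchange C b a d c \<cdot> (Braid C a b \<odot> Braid C c d) \<cdot> interchange C a c b d"
    by (simp add: Comp_Ten')
  finally show ?thesis
    by (simp add: Comp_assoc_arr interchange_interchange)
qed

end

section \<open>Shuffle products of models of a prop\<close>

context symmetric_strict_monoidal_category
begin

lemma pow_Suc: "a \<in> Obj C \<Longrightarrow> pow C a (Suc n) = pow C a n \<otimes> a"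
  by (cases n) auto

lemma pow_add: "a \<in> Obj C \<Longrightarrow> pow C a (m + n) = pow C a m \<otimes> pow C a n"
  by (induction n) (auto simp: pow_Suc simp del: pow_Suc_Suc)

lemma pow_Unit [simp]: "pow C (UnitO C) n = UnitO C"
  by (induction n) (auto simp: pow_Suc simp del: pow_Suc_Suc)

lemma shuffle_0 [simp]: "shuffle C a b 0 = Id C (UnitO C)"
  by simp

text \<open>Strict units let the recursion start at \<open>n = 0\<close>. The defining equations
  treat exponent one apart because \<open>pow C c (Suc 0)\<close> is \<open>c\<close> itself and not
  a product with the unit.\<close>

lemma shuffle_Suc:
  assumes [simp]: "a \<in> Obj C" "b \<in> Obj C"
  shows "shuffle C a b (Suc n) =
    (shuffle C a b n \<odot> Id C (a \<otimes> b)) \<cdot> interchange C (pow C a n) a (pow C b n) b"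
  by (cases n) (auto simp: interchange_strict)

declare shuffle.simps [simp del]

lemma shuffle_1 [simp]: "shuffle C a b (Suc 0) = Id C (a \<otimes> b)"
  by (simp add: shuffle.simps)

lemma shuffle_Unit_left [simp]: "a \<in> Obj C \<Longrightarrow> shuffle C (UnitO C) a n = Id C (pow C a n)"
  by (induction n) (auto simp: shuffle_Suc pow_Suc interchange_strict simp del: pow_Suc_Suc)

lemma shuffle_Unit_right [simp]: "a \<in> Obj C \<Longrightarrow> shuffle C a (UnitO C) n = Id C (pow C a n)"
  by (induction n) (auto simp: shuffle_Suc pow_Suc interchange_strict simp del: pow_Suc_Suc)

lemma unit_shuffle_strict [simp]: "unit_shuffle C n = Id C (UnitO C)"
  by (induction n rule: induct_nat_012) auto

text \<open>Splitting off the last factor reduces the claim to \<open>interchange_assoc\<close> for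
  blocks of sizes \<open>m\<close>, \<open>n\<close> and one. It makes conjugation by shuffles
  compatible with the tensor product of the prop, which is addition on objects.\<close>

lemma shuffle_add:
  assumes [simp]: "a \<in> Obj C" "b \<in> Obj C"
  shows "shuffle C a b (m + n) = (shuffle C a b m \<odot> shuffle C a b n) \<cdot>
    interchange C (pow C a m) (pow C a n) (pow C b m) (pow C b n)"
proof (induction n)
  case 0
  then show ?case by (simp add: interchange_strict)
next
  case (Suc n)
  let ?a = "pow C a" and ?b = "pow C b" and ?s = "shuffle C a b"
  have "?s (m + Suc n) = (?s (m + n) \<odot> Id C (a \<otimes> b)) \<cdot> interchange C (?a (m + n)) a (?b (m + n)) b"
    by (simp add: shuffle_Suc)
  also have "\<dots> = ((?s m \<odot> ?s n) \<odot> Id C (a \<otimes> b)) \<cdot>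
    (interchange C (?a m) (?a n) (?b m) (?b n) \<odot> Id C (a \<otimes> b)) \<cdot>
    interchange C (?a m \<otimes> ?a n) a (?b m \<otimes> ?b n) b"
    unfolding Suc by (simp add: pow_add Comp_Ten')
  also have "\<dots> = ((?s m \<odot> ?s n) \<odot> Id C (a \<otimes> b)) \<cdot>
    (Id C (?a m \<otimes> ?b m) \<odot> interchange C (?a n) a (?b n) b) \<cdot>
    interchange C (?a m) (?a n \<otimes> a) (?b m) (?b n \<otimes> b)"
    by (simp add: interchange_assoc)
  also have "\<dots> = (?s m \<odot> ?s (Suc n)) \<cdot>
    interchange C (?a m) (?a (Suc n)) (?b m) (?b (Suc n))"
    by (simp add: pow_Suc shuffle_Suc Ten_assoc Comp_Ten' del: pow_Suc_Suc)
  finally show ?case .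
qed

lemma Comp_Ten_Id: "\<lbrakk>f \<in> Arr C; g \<in> Arr C; Cod C f = Dom C g; a \<in> Obj C\<rbrakk> \<Longrightarrow>
    (g \<cdot> f) \<odot> Id C a = (g \<odot> Id C a) \<cdot> (f \<odot> Id C a)"
  by (simp add: Comp_Ten)

lemma Id_Ten_Comp: "\<lbrakk>f \<in> Arr C; g \<in> Arr C; Cod C f = Dom C g; a \<in> Obj C\<rbrakk> \<Longrightarrow>
    Id C a \<odot> (g \<cdot> f) = (Id C a \<odot> g) \<cdot> (Id C a \<odot> f)"
  by (simp add: Comp_Ten)

lemma Ten_Id_Id:
  "\<lbrakk>f \<in> Arr C; a \<in> Obj C; b \<in> Obj C\<rbrakk> \<Longrightarrow> (f \<odot> Id C a) \<odot> Id C b = f \<odot> Id C (a \<otimes> b)"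
  "\<lbrakk>f \<in> Arr C; a \<in> Obj C; b \<in> Obj C\<rbrakk> \<Longrightarrow> Id C a \<odot> (Id C b \<odot> f) = Id C (a \<otimes> b) \<odot> f"
  "\<lbrakk>f \<in> Arr C; a \<in> Obj C; b \<in> Obj C\<rbrakk> \<Longrightarrow> (Id C a \<odot> f) \<odot> Id C b = Id C a \<odot> (f \<odot> Id C b)"
  by (simp_all add: Ten_assoc flip: Ten_assoc[of "Id C a" "Id C b"])

text \<open>Both sides interleave three families of factors. In the induction step the shorter
  shuffles move past the last interchanges by naturality (\<open>left\<close> and
  \<open>right\<close>), and \<open>interchange_assoc'\<close> compares what remains.\<close>

lemma shuffle_assoc:
  assumes [simp]: "a \<in> Obj C" "b \<in> Obj C" "c \<in> Obj C"
  shows "shuffle C (a \<otimes> b) c n \<cdot> (shuffle C a b n \<odot> Id C (pow C c n)) =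
    shuffle C a (b \<otimes> c) n \<cdot> (Id C (pow C a n) \<odot> shuffle C b c n)"
proof (induction n)
  case 0
  then show ?case by simp
next
  case (Suc n)
  let ?a = "pow C a n" and ?b = "pow C b n" and ?c = "pow C c n"
  let ?ab = "pow C (a \<otimes> b) n" and ?bc = "pow C (b \<otimes> c) n"
  have left: "interchange C ?ab (a \<otimes> b) ?c c \<cdot> (shuffle C a b n \<odot> Id C (a \<otimes> (b \<otimes> (?c \<otimes> c)))) =
    (shuffle C a b n \<odot> Id C (?c \<otimes> (a \<otimes> (b \<otimes> c)))) \<cdot> interchange C (?a \<otimes> ?b) (a \<otimes> b) ?c c"
    using interchange_natural_strict[of "shuffle C a b n" "Id C (a \<otimes> b)" "Id C ?c" "Id C c", OF _ _ _ _ refl refl refl refl]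
    by simp
  have right: "interchange C ?a a ?bc (b \<otimes> c) \<cdot> (Id C (?a \<otimes> a) \<odot> (shuffle C b c n \<odot> Id C (b \<otimes> c))) =
    (Id C ?a \<odot> (shuffle C b c n \<odot> Id C (a \<otimes> (b \<otimes> c)))) \<cdot> interchange C ?a a (?b \<otimes> ?c) (b \<otimes> c)"
    using interchange_natural_strict[of "Id C ?a" "Id C a" "shuffle C b c n" "Id C (b \<otimes> c)", OF _ _ _ _ refl refl refl refl]
    by (simp add: Ten_Id_Id)
  have "shuffle C (a \<otimes> b) c (Suc n) \<cdot> (shuffle C a b (Suc n) \<odot> Id C (?c \<otimes> c)) =
    (shuffle C (a \<otimes> b) c n \<odot> Id C (a \<otimes> (b \<otimes> c))) \<cdot>
    (interchange C ?ab (a \<otimes> b) ?c c \<cdot> (shuffle C a b n \<odot> Id C (a \<otimes> (b \<otimes> (?c \<otimes> c))))) \<cdot>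
    (interchange C ?a a ?b b \<odot> Id C (?c \<otimes> c))"
    by (simp add: shuffle_Suc Comp_Ten_Id Ten_Id_Id Comp_assoc_arr)
  also have "\<dots> = ((shuffle C (a \<otimes> b) c n \<cdot> (shuffle C a b n \<odot> Id C ?c)) \<odot> Id C (a \<otimes> (b \<otimes> c))) \<cdot>
     interchange C (?a \<otimes> ?b) (a \<otimes> b) ?c c \<cdot> (interchange C ?a a ?b b \<odot> Id C (?c \<otimes> c))"
    unfolding left by (simp add: Comp_Ten_Id Ten_Id_Id Comp_assoc_arr)
  also have "\<dots> = ((shuffle C a (b \<otimes> c) n \<cdot> (Id C ?a \<odot> shuffle C b c n)) \<odot> Id C (a \<otimes> (b \<otimes> c))) \<cdot>
     interchange C ?a a (?b \<otimes> ?c) (b \<otimes> c) \<cdot> (Id C (?a \<otimes> a) \<odot> interchange C ?b b ?c c)"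
    unfolding Suc by (simp add: interchange_assoc')
  also have "\<dots> = (shuffle C a (b \<otimes> c) n \<odot> Id C (a \<otimes> (b \<otimes> c))) \<cdot>
    (interchange C ?a a ?bc (b \<otimes> c) \<cdot> (Id C (?a \<otimes> a) \<odot> (shuffle C b c n \<odot> Id C (b \<otimes> c)))) \<cdot>
    (Id C (?a \<otimes> a) \<odot> interchange C ?b b ?c c)"
    unfolding right by (simp add: Comp_Ten_Id Ten_Id_Id Comp_assoc_arr)
  also have "\<dots> = shuffle C a (b \<otimes> c) (Suc n) \<cdot> (Id C (?a \<otimes> a) \<odot> shuffle C b c (Suc n))"
    by (simp add: shuffle_Suc Id_Ten_Comp Comp_assoc_arr)
  finally show ?case
    by (simp add: pow_Suc del: pow_Suc_Suc)
qed

lemma tens_snoc_strict: "as \<in> lists (Obj C) \<Longrightarrow> b \<in> Obj C \<Longrightarrow> tens C (as @ [b]) = tens C as \<otimes> b"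
  by (cases "as = []") (auto simp: tens_snoc)

lemma tens_append: "as \<in> lists (Obj C) \<Longrightarrow> bs \<in> lists (Obj C) \<Longrightarrow> tens C (as @ bs) = tens C as \<otimes> tens C bs"
proof (induction bs rule: rev_induct)
  case (snoc b bs)
  then show ?case
    using tens_snoc_strict[of "as @ bs" b] by (auto simp: tens_snoc_strict)
qed simp

lemma tens_mor_snoc: "f \<in> Arr C \<Longrightarrow> tens_mor C (fs @ [f]) = tens_mor C fs \<odot> f"
  by (cases fs) auto

lemma multi_shuffle_Nil [simp]: "multi_shuffle C [] n = Id C (UnitO C)"
  by (simp add: multi_shuffle_def)

text \<open>A shuffle with the unit is an identity in a strict category, so the separate one-element
  equation of the definition is absorbed as the case of empty \<open>cs\<close>.\<close>

lemma multi_shuffle_snoc: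
  assumes "cs \<in> lists (Obj C)" "c \<in> Obj C"
  shows "multi_shuffle C (cs @ [c]) n =
    shuffle C (tens C cs) c n \<cdot> (multi_shuffle C cs n \<odot> Id C (pow C c n))"
proof (cases "rev cs")
  case Nil
  then show ?thesis using assms by (simp add: multi_shuffle_def)
next
  case (Cons d ds)
  then have "cs = rev ds @ [d]"
    by simp
  then show ?thesis by (simp add: multi_shuffle_def)
qed

lemma multi_shuffle_arr:
  "cs \<in> lists (Obj C) \<Longrightarrow> invertible C (multi_shuffle C cs n) \<and>
    Dom C (multi_shuffle C cs n) = tens C (map (\<lambda>c. pow C c n) cs) \<and>
    Cod C (multi_shuffle C cs n) = pow C (tens C cs) n"
proof (induction cs rule: rev_induct)
  case (snoc c cs)
  then have "tens C (map (\<lambda>c. pow C c n) cs @ [pow C c n]) = tens C (map (\<lambda>c. pow C c n) cs) \<otimes> pow C c n"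
    by (intro tens_snoc_strict) auto
  with snoc show ?case
    by (auto simp: multi_shuffle_snoc tens_snoc_strict invertible_arr)
qed simp

lemmas multi_shuffle_simps [simp] =
  multi_shuffle_arr[THEN conjunct1]
  multi_shuffle_arr[THEN conjunct2, THEN conjunct1]
  multi_shuffle_arr[THEN conjunct2, THEN conjunct2]
  multi_shuffle_arr[THEN conjunct1, THEN invertible_arr]

end

section \<open>Strict models of a prop and their shuffle products\<close>

locale prop_in_strict =
  P: prop_category P + symmetric_strict_monoidal_category C
  for P :: "(nat, 'p) smc" and C :: "('o, 'm) smc" (structure)
begin

declare P.Ten_add [simp] P.Obj_nat [simp] P.Unit_zero [simp]

text \<open>A strict symmetric monoidal functor from \<open>P\<close> sending \<open>1\<close> to
  \<open>a\<close>, recorded by its arrow map alone: the objects of \<open>P\<close> are the natural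
  numbers, so strictness forces the object map to be \<open>pow C a\<close>, and the strongators are
  identities.\<close>

definition strict_model :: "'o \<Rightarrow> ('p \<Rightarrow> 'm) \<Rightarrow> bool" where
  "strict_model a f \<longleftrightarrow>
     (\<forall>\<mu>\<in>Arr P. f \<mu> \<in> hom C (pow C a (Dom P \<mu>)) (pow C a (Cod P \<mu>))) \<and>
     (\<forall>n. f (Id P n) = Id C (pow C a n)) \<and>
     (\<forall>\<mu>\<in>Arr P. \<forall>\<nu>\<in>Arr P. Cod P \<mu> = Dom P \<nu> \<longrightarrow> f (\<nu> \<cdot>\<^bsub>P\<^esub> \<mu>) = f \<nu> \<cdot> f \<mu>) \<and>
     (\<forall>\<mu>\<in>Arr P. \<forall>\<nu>\<in>Arr P. f (\<mu> \<odot>\<^bsub>P\<^esub> \<nu>) = f \<mu> \<odot> f \<nu>) \<and>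
     (\<forall>m n. f (Braid P m n) = Braid C (pow C a m) (pow C a n))"

definition shuffle_product :: "'o \<Rightarrow> 'o \<Rightarrow> ('p \<Rightarrow> 'm) \<Rightarrow> ('p \<Rightarrow> 'm) \<Rightarrow> 'p \<Rightarrow> 'm" where
  "shuffle_product a b f g \<mu> =
     shuffle C a b (Cod P \<mu>) \<cdot> (f \<mu> \<odot> g \<mu>) \<cdot> Inv C (shuffle C a b (Dom P \<mu>))"

lemma strict_model_arr [simp]:
  "strict_model a f \<Longrightarrow> \<mu> \<in> Arr P \<Longrightarrow> f \<mu> \<in> Arr C"
  "strict_model a f \<Longrightarrow> \<mu> \<in> Arr P \<Longrightarrow> Dom C (f \<mu>) = pow C a (Dom P \<mu>)"
  "strict_model a f \<Longrightarrow> \<mu> \<in> Arr P \<Longrightarrow> Cod C (f \<mu>) = pow C a (Cod P \<mu>)"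
  by (auto simp: strict_model_def in_hom_iff)

lemma shuffle_product_arr:
  assumes [simp]: "a \<in> Obj C" "b \<in> Obj C" "strict_model a f" "strict_model b g" "\<mu> \<in> Arr P"
  shows "shuffle_product a b f g \<mu> \<in> Arr C"
    "Dom C (shuffle_product a b f g \<mu>) = pow C (a \<otimes> b) (Dom P \<mu>)"
    "Cod C (shuffle_product a b f g \<mu>) = pow C (a \<otimes> b) (Cod P \<mu>)"
  by (simp_all add: shuffle_product_def strict_model_arr[of a f] strict_model_arr[of b g])

lemma shuffle_product_shuffle:
  assumes [simp]: "a \<in> Obj C" "b \<in> Obj C" "strict_model a f" "strict_model b g" "\<mu> \<in> Arr P"
  shows "shuffle_product a b f g \<mu> \<cdot> shuffle C a b (Dom P \<mu>) =
    shuffle C a b (Cod P \<mu>) \<cdot> (f \<mu> \<odot> g \<mu>)"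
  by (simp add: shuffle_product_def Comp_assoc_arr strict_model_arr[of a f] strict_model_arr[of b g])

text \<open>Shuffles are invertible, so the square \<open>shuffle_product_shuffle\<close> determines
  the arrow. Identities between shuffle products can thus be checked without handling inverse
  shuffles.\<close>

lemma shuffle_product_eqI:
  assumes "a \<in> Obj C" "b \<in> Obj C" "strict_model a f" "strict_model b g" "\<mu> \<in> Arr P"
    "k \<in> Arr C" "Dom C k = pow C (a \<otimes> b) (Dom P \<mu>)" "Cod C k = pow C (a \<otimes> b) (Cod P \<mu>)"
    "k \<cdot> shuffle C a b (Dom P \<mu>) = shuffle C a b (Cod P \<mu>) \<cdot> (f \<mu> \<odot> g \<mu>)"
  shows "shuffle_product a b f g \<mu> = k"
  by (rule cancel_right[of _ "shuffle C a b (Dom P \<mu>)"])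
    (use assms in \<open>simp_all add: shuffle_product_shuffle shuffle_product_arr\<close>)

text \<open>Every clause is verified through \<open>shuffle_product_eqI\<close>. Tensor products
  reduce by \<open>shuffle_add\<close> to naturality of the interchange and braidings to
  \<open>Braid_interchange\<close>; identities and composites are formal.\<close>

lemma strict_model_shuffle_product:
  assumes [simp]: "a \<in> Obj C" "b \<in> Obj C" and f [simp]: "strict_model a f" and g [simp]: "strict_model b g"
  shows "strict_model (a \<otimes> b) (shuffle_product a b f g)"
proof -
  note [simp] = shuffle_product_arr strict_model_arr[OF f] strict_model_arr[OF g]
  let ?h = "shuffle_product a b f g"
  have Id: "?h (Id P n) = Id C (pow C (a \<otimes> b) n)" for n
    by (rule shuffle_product_eqI) (use f g in \<open>simp_all add: strict_model_def\<close>)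
  have Comp: "?h (\<nu> \<cdot>\<^bsub>P\<^esub> \<mu>) = ?h \<nu> \<cdot> ?h \<mu>"
    if [simp]: "\<mu> \<in> Arr P" "\<nu> \<in> Arr P" "Cod P \<mu> = Dom P \<nu>" for \<mu> \<nu>
  proof (rule shuffle_product_eqI)
    have "(?h \<nu> \<cdot> ?h \<mu>) \<cdot> shuffle C a b (Dom P \<mu>) =
      (?h \<nu> \<cdot> shuffle C a b (Dom P \<nu>)) \<cdot> (f \<mu> \<odot> g \<mu>)"
      using shuffle_product_shuffle[of a b f g \<mu>] by (simp add: Comp_assoc_arr)
    also have "\<dots> = shuffle C a b (Cod P \<nu>) \<cdot> ((f \<nu> \<cdot> f \<mu>) \<odot> (g \<nu> \<cdot> g \<mu>))"
      by (simp add: shuffle_product_shuffle Comp_assoc_arr Comp_Ten)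
    finally show "(?h \<nu> \<cdot> ?h \<mu>) \<cdot> shuffle C a b (Dom P (\<nu> \<cdot>\<^bsub>P\<^esub> \<mu>)) =
      shuffle C a b (Cod P (\<nu> \<cdot>\<^bsub>P\<^esub> \<mu>)) \<cdot> (f (\<nu> \<cdot>\<^bsub>P\<^esub> \<mu>) \<odot> g (\<nu> \<cdot>\<^bsub>P\<^esub> \<mu>))"
      using f g by (simp add: strict_model_def)
  qed simp_all
  have Ten: "?h (\<mu> \<odot>\<^bsub>P\<^esub> \<nu>) = ?h \<mu> \<odot> ?h \<nu>" if [simp]: "\<mu> \<in> Arr P" "\<nu> \<in> Arr P" for \<mu> \<nu>
  proof (rule shuffle_product_eqI)
    let ?m = "Dom P \<mu>" and ?m' = "Dom P \<nu>" and ?n = "Cod P \<mu>" and ?n' = "Cod P \<nu>"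
    have "(?h \<mu> \<odot> ?h \<nu>) \<cdot> shuffle C a b (?m + ?m') =
      ((?h \<mu> \<cdot> shuffle C a b ?m) \<odot> (?h \<nu> \<cdot> shuffle C a b ?m')) \<cdot>
        interchange C (pow C a ?m) (pow C a ?m') (pow C b ?m) (pow C b ?m')"
      by (simp add: shuffle_add Comp_Ten')
    also have "\<dots> = (shuffle C a b ?n \<odot> shuffle C a b ?n') \<cdot> (f \<mu> \<odot> (g \<mu> \<odot> (f \<nu> \<odot> g \<nu>))) \<cdot>
        interchange C (pow C a ?m) (pow C a ?m') (pow C b ?m) (pow C b ?m')"
      by (simp add: shuffle_product_shuffle Comp_Ten' flip: Ten_assoc[of "f \<mu>" "g \<mu>"])
    also have "\<dots> = (shuffle C a b ?n \<odot> shuffle C a b ?n') \<cdot>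
        interchange C (pow C a ?n) (pow C a ?n') (pow C b ?n) (pow C b ?n') \<cdot>
        (f \<mu> \<odot> (f \<nu> \<odot> (g \<mu> \<odot> g \<nu>)))"
      by (simp add: interchange_natural_strict)
    also have "\<dots> = shuffle C a b (?n + ?n') \<cdot> ((f \<mu> \<odot> f \<nu>) \<odot> (g \<mu> \<odot> g \<nu>))"
      by (simp add: shuffle_add Comp_assoc_arr Ten_assoc)
    finally show "(?h \<mu> \<odot> ?h \<nu>) \<cdot> shuffle C a b (Dom P (\<mu> \<odot>\<^bsub>P\<^esub> \<nu>)) =
      shuffle C a b (Cod P (\<mu> \<odot>\<^bsub>P\<^esub> \<nu>)) \<cdot> (f (\<mu> \<odot>\<^bsub>P\<^esub> \<nu>) \<odot> g (\<mu> \<odot>\<^bsub>P\<^esub> \<nu>))"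
      using f g by (simp add: strict_model_def)
  qed (simp_all add: pow_add)
  have Braid: "?h (Braid P m n) = Braid C (pow C (a \<otimes> b) m) (pow C (a \<otimes> b) n)" for m n
  proof (rule shuffle_product_eqI)
    let ?B = "Braid C (pow C (a \<otimes> b) m) (pow C (a \<otimes> b) n)"
    have "?B \<cdot> shuffle C a b (m + n) = (?B \<cdot> (shuffle C a b m \<odot> shuffle C a b n)) \<cdot>
      interchange C (pow C a m) (pow C a n) (pow C b m) (pow C b n)"
      by (simp add: shuffle_add Comp_assoc_arr)
    also have "\<dots> = (shuffle C a b n \<odot> shuffle C a b m) \<cdot>
      Braid C (pow C a m \<otimes> pow C b m) (pow C a n \<otimes> pow C b n) \<cdot>
      interchange C (pow C a m) (pow C a n) (pow C b m) (pow C b n)"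
      by (simp add: Braid_nat Comp_assoc_arr)
    also have "\<dots> = shuffle C a b (n + m) \<cdot>
      (Braid C (pow C a m) (pow C a n) \<odot> Braid C (pow C b m) (pow C b n))"
      by (simp add: Braid_interchange shuffle_add Comp_assoc_arr)
    finally show "?B \<cdot> shuffle C a b (Dom P (Braid P m n)) = shuffle C a b (Cod P (Braid P m n)) \<cdot>
      (f (Braid P m n) \<odot> g (Braid P m n))"
      using f g by (simp add: strict_model_def)
  qed (simp_all add: pow_add)
  show ?thesis
    using Id Comp Ten Braid unfolding strict_model_def by (simp add: in_hom_iff)
qed

text \<open>The right-hand side satisfies the square that characterizes the left-hand one: after
  precomposition with the inner shuffle, \<open>shuffle_assoc\<close> exchanges the two bracketings
  at the domain and at the codomain.\<close>

lemma shuffle_product_assoc: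
  assumes [simp]: "a \<in> Obj C" "b \<in> Obj C" "c \<in> Obj C"
    and f [simp]: "strict_model a f" and g [simp]: "strict_model b g" and h [simp]: "strict_model c h"
    and [simp]: "\<mu> \<in> Arr P"
  shows "shuffle_product (a \<otimes> b) c (shuffle_product a b f g) h \<mu> =
    shuffle_product a (b \<otimes> c) f (shuffle_product b c g h) \<mu>"
proof (rule shuffle_product_eqI)
  note [simp] = shuffle_product_arr strict_model_arr[OF f] strict_model_arr[OF g] strict_model_arr[OF h]
    strict_model_shuffle_product
  let ?fg = "shuffle_product a b f g" and ?gh = "shuffle_product b c g h"
  let ?k = "shuffle_product a (b \<otimes> c) f ?gh \<mu>"
  let ?m = "Dom P \<mu>" and ?n = "Cod P \<mu>"
  have "(?k \<cdot> shuffle C (a \<otimes> b) c ?m) \<cdot> (shuffle C a b ?m \<odot> Id C (pow C c ?m)) =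
    ?k \<cdot> shuffle C a (b \<otimes> c) ?m \<cdot> (Id C (pow C a ?m) \<odot> shuffle C b c ?m)"
    by (simp add: shuffle_assoc Comp_assoc_arr)
  also have "\<dots> = (?k \<cdot> shuffle C a (b \<otimes> c) ?m) \<cdot> (Id C (pow C a ?m) \<odot> shuffle C b c ?m)"
    by (simp add: Comp_assoc_arr)
  also have "\<dots> = shuffle C a (b \<otimes> c) ?n \<cdot> (f \<mu> \<odot> (?gh \<mu> \<cdot> shuffle C b c ?m))"
    by (simp add: shuffle_product_shuffle Comp_assoc_arr Comp_Ten)
  also have "\<dots> = (shuffle C a (b \<otimes> c) ?n \<cdot> (Id C (pow C a ?n) \<odot> shuffle C b c ?n)) \<cdot> (f \<mu> \<odot> (g \<mu> \<odot> h \<mu>))"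
    by (simp add: shuffle_product_shuffle Comp_assoc_arr Comp_Ten)
  also have "\<dots> = shuffle C (a \<otimes> b) c ?n \<cdot> (shuffle C a b ?n \<odot> Id C (pow C c ?n)) \<cdot> ((f \<mu> \<odot> g \<mu>) \<odot> h \<mu>)"
    unfolding shuffle_assoc[OF assms(1-3), symmetric] by (simp add: Comp_assoc_arr Ten_assoc)
  also have "\<dots> = shuffle C (a \<otimes> b) c ?n \<cdot> ((?fg \<mu> \<cdot> shuffle C a b ?m) \<odot> h \<mu>)"
    by (simp add: shuffle_product_shuffle Comp_Ten)
  also have "\<dots> = (shuffle C (a \<otimes> b) c ?n \<cdot> (?fg \<mu> \<odot> h \<mu>)) \<cdot> (shuffle C a b ?m \<odot> Id C (pow C c ?m))"
    by (simp add: Comp_assoc_arr Comp_Ten)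
  finally show "?k \<cdot> shuffle C (a \<otimes> b) c ?m = shuffle C (a \<otimes> b) c ?n \<cdot> (?fg \<mu> \<odot> h \<mu>)"
    by (rule cancel_right) simp_all
qed (simp_all add: strict_model_shuffle_product shuffle_product_arr)

lemma strict_model_Unit: "strict_model (UnitO C) (\<lambda>\<mu>. Id C (UnitO C))"
  by (simp add: strict_model_def in_hom_iff)

lemma shuffle_product_Unit:
  assumes [simp]: "a \<in> Obj C" "strict_model a f" "\<mu> \<in> Arr P"
  shows "shuffle_product (UnitO C) a (\<lambda>\<mu>. Id C (UnitO C)) f \<mu> = f \<mu>"
    "shuffle_product a (UnitO C) f (\<lambda>\<mu>. Id C (UnitO C)) \<mu> = f \<mu>"
  by (simp_all add: shuffle_product_def strict_model_arr[of a f])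

text \<open>The composite defining the induced supply, in any strict category. It will be used in
  the strictification for lists of one-element lists. Only on those is the family \<open>f\<close>
  known to consist of models, whence the set \<open>X\<close> in the context below.\<close>

definition multi_product :: "('o \<Rightarrow> 'p \<Rightarrow> 'm) \<Rightarrow> 'o list \<Rightarrow> 'p \<Rightarrow> 'm" where
  "multi_product f cs \<mu> =
     multi_shuffle C cs (Cod P \<mu>) \<cdot> tens_mor C (map (\<lambda>c. f c \<mu>) cs) \<cdot>
     Inv C (multi_shuffle C cs (Dom P \<mu>))"

lemma multi_product_Nil: "multi_product f [] = (\<lambda>\<mu>. Id C (UnitO C))"
  by (simp add: multi_product_def fun_eq_iff)

text \<open>Agreement on \<open>Arr P\<close> has to suffice because the recursion
  \<open>multi_product_snoc\<close> is available only there.\<close>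

lemma strict_model_cong:
  assumes "strict_model a g" "\<And>\<mu>. \<mu> \<in> Arr P \<Longrightarrow> h \<mu> = g \<mu>"
  shows "strict_model a h"
  using assms by (simp add: strict_model_def)

context
  fixes f :: "'o \<Rightarrow> 'p \<Rightarrow> 'm" and X :: "'o set"
  assumes X: "X \<subseteq> Obj C" and f: "\<And>c. c \<in> X \<Longrightarrow> strict_model c (f c)"
begin

lemma X_Obj [simp]: "c \<in> X \<Longrightarrow> c \<in> Obj C"
  using X by auto

lemma lists_X [simp]: "cs \<in> lists X \<Longrightarrow> cs \<in> lists (Obj C)"
  using X by auto

lemma tens_mor_arr:
  assumes "cs \<in> lists X" "\<mu> \<in> Arr P"
  shows "tens_mor C (map (\<lambda>c. f c \<mu>) cs) \<in> hom C
    (tens C (map (\<lambda>c. pow C c (Dom P \<mu>)) cs)) (tens C (map (\<lambda>c. pow C c (Cod P \<mu>)) cs))"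
  using assms(1)
proof (induction cs rule: rev_induct)
  case (snoc c cs)
  then have [simp]: "c \<in> Obj C" "cs \<in> lists (Obj C)" using X by auto
  have "tens C (map (\<lambda>c. pow C c n) cs @ [pow C c n]) = tens C (map (\<lambda>c. pow C c n) cs) \<otimes> pow C c n" for n
    using snoc.prems by (intro tens_snoc_strict) auto
  then show ?case
    using snoc f[of c] assms(2)
    by (auto simp: in_hom_iff tens_snoc_strict tens_mor_snoc strict_model_arr[of c "f c"])
qed (simp add: in_hom_iff)

text \<open>Since \<open>multi_shuffle_snoc\<close> factors the multiple shuffle through a binary
  one, the conjugations nest, and the identities on the last factor disappear.\<close>

lemma multi_product_snoc:
  assumes "cs \<in> lists X" "c \<in> X" "\<mu> \<in> Arr P"
  shows "multi_product f (cs @ [c]) \<mu> = shuffle_product (tens C cs) c (multi_product f cs) (f c) \<mu>"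
proof -
  have [simp]: "c \<in> Obj C" "cs \<in> lists (Obj C)" using assms X by auto
  note [simp] = strict_model_arr[OF f[OF assms(2)]] tens_mor_arr[unfolded in_hom_iff]
  show ?thesis
    using assms
    by (simp add: multi_product_def shuffle_product_def multi_shuffle_snoc tens_mor_snoc
        Inv_Comp Inv_Ten Comp_assoc_arr Comp_Ten Comp_Ten')
qed

lemma multi_product_single:
  assumes "c \<in> X" "\<mu> \<in> Arr P"
  shows "multi_product f [c] \<mu> = f c \<mu>"
proof -
  have "c \<in> Obj C" using assms X by auto
  then show ?thesis
    using assms multi_product_snoc[of "[]" c \<mu>] f[of c]
    by (simp add: multi_product_Nil shuffle_product_Unit)
qed

lemma strict_model_multi_product: "cs \<in> lists X \<Longrightarrow> strict_model (tens C cs) (multi_product f cs)"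
proof (induction cs rule: rev_induct)
  case (snoc c cs)
  then have [simp]: "c \<in> Obj C" "cs \<in> lists (Obj C)" using X by auto
  have "strict_model (tens C cs \<otimes> c) (shuffle_product (tens C cs) c (multi_product f cs) (f c))"
    using snoc f[of c] by (simp add: strict_model_shuffle_product)
  then have "strict_model (tens C cs \<otimes> c) (multi_product f (cs @ [c]))"
    by (rule strict_model_cong) (use snoc.prems in \<open>auto intro!: multi_product_snoc\<close>)
  then show ?case
    by (simp add: tens_snoc_strict)
qed (simp add: multi_product_Nil strict_model_Unit)

text \<open>Appending one entry is a shuffle product, and \<open>shuffle_product_assoc\<close>
  regroups the entries appended one by one. This is the source of \<open>supply_tensor\<close> for
  the induced supply.\<close>

lemma multi_product_append:
  assumes "cs \<in> lists X" "ds \<in> lists X" "\<mu> \<in> Arr P"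
  shows "multi_product f (cs @ ds) \<mu> =
    shuffle_product (tens C cs) (tens C ds) (multi_product f cs) (multi_product f ds) \<mu>"
  using assms(2)
proof (induction ds rule: rev_induct)
  case Nil
  then show ?case
    using assms strict_model_multi_product[of cs]
    by (simp add: multi_product_Nil shuffle_product_Unit)
next
  case (snoc d ds)
  then have d: "d \<in> X" and ds: "ds \<in> lists X" by auto
  then have [simp]: "d \<in> Obj C" "ds \<in> lists (Obj C)" "cs \<in> lists (Obj C)"
    using X assms by auto
  note models = strict_model_multi_product[OF assms(1)] strict_model_multi_product[OF ds] f[OF d]
  have "multi_product f (cs @ ds @ [d]) \<mu> =
    shuffle_product (tens C (cs @ ds)) d (multi_product f (cs @ ds)) (f d) \<mu>"
    using multi_product_snoc[of "cs @ ds" d \<mu>] assms d ds by simp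
  \<comment> \<open>A shuffle product at \<open>\<mu>\<close> sees its factors only through their
    values at \<open>\<mu>\<close>. Unfolding it therefore makes the induction hypothesis
    applicable, which is an equation at \<open>\<mu>\<close> and not between functions.\<close>
  also have "\<dots> = shuffle_product (tens C cs \<otimes> tens C ds) d
      (shuffle_product (tens C cs) (tens C ds) (multi_product f cs) (multi_product f ds)) (f d) \<mu>"
    using snoc.IH[OF ds] by (simp add: shuffle_product_def[of _ d] tens_append)
  also have "\<dots> = shuffle_product (tens C cs) (tens C ds \<otimes> d) (multi_product f cs)
      (shuffle_product (tens C ds) d (multi_product f ds) (f d)) \<mu>"
    using models assms by (simp add: shuffle_product_assoc)
  also have "\<dots> = shuffle_product (tens C cs) (tens C (ds @ [d])) (multi_product f cs)
      (multi_product f (ds @ [d])) \<mu>"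
    using multi_product_snoc[OF ds d assms(3)] by (simp add: shuffle_product_def[of "tens C cs"] tens_snoc_strict)
  finally show ?case .
qed

end

end

section \<open>The strictification\<close>

lemma strictification_simps [simp]:
  "Obj (strictification C) = lists (Obj C)"
  "(as, bs, f) \<in> Arr (strictification C) \<longleftrightarrow>
     as \<in> lists (Obj C) \<and> bs \<in> lists (Obj C) \<and> f \<in> Arr C \<and> Dom C f = tens C as \<and> Cod C f = tens C bs"
  "Dom (strictification C) (as, bs, f) = as"
  "Cod (strictification C) (as, bs, f) = bs"
  "Id (strictification C) as = (as, as, Id C (tens C as))"
  "Comp (strictification C) (bs', cs, g) (as, bs, f) = (as, cs, g \<cdot>\<^bsub>C\<^esub> f)"
  "TenO (strictification C) = (@)"
  "TenM (strictification C) (as, bs, f) (as', bs', g) =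
     (as @ as', bs @ bs',
      rebracket C bs bs' \<cdot>\<^bsub>C\<^esub> (f \<odot>\<^bsub>C\<^esub> g) \<cdot>\<^bsub>C\<^esub> Inv C (rebracket C as as'))"
  "UnitO (strictification C) = []"
  "Assoc (strictification C) as bs cs = (as @ bs @ cs, as @ bs @ cs, Id C (tens C (as @ bs @ cs)))"
  "LUnit (strictification C) as = (as, as, Id C (tens C as))"
  "RUnit (strictification C) as = (as, as, Id C (tens C as))"
  "Braid (strictification C) as bs =
     (as @ bs, bs @ as,
      rebracket C bs as \<cdot>\<^bsub>C\<^esub> Braid C (tens C as) (tens C bs) \<cdot>\<^bsub>C\<^esub> Inv C (rebracket C as bs))"
  by (auto simp: strictification_def hom_def)

lemma hom_strictificationE:
  assumes "f \<in> hom (strictification C) as bs"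
  obtains g where "f = (as, bs, g)" "as \<in> lists (Obj C)" "bs \<in> lists (Obj C)" "g \<in> Arr C"
    "Dom C g = tens C as" "Cod C g = tens C bs"
  using assms that by (cases f) (auto simp: in_hom_iff)

context symmetric_monoidal_category
begin

lemma category_strictification: "category (strictification C)"
proof
  show "Dom (strictification C) f \<in> Obj (strictification C)"
    "Cod (strictification C) f \<in> Obj (strictification C)" if "f \<in> Arr (strictification C)" for f
    using that by (cases f; simp)+
qed (auto simp: in_hom_iff Comp_assoc_arr elim!: hom_strictificationE)

text \<open>Rebracketing against an empty list is a unitor; conjugation by it removes the unit
  factor by naturality. This gives the strict unit law for arrows of the strictification.\<close>

lemma LUnit_conjugate:
  "f \<in> Arr C \<Longrightarrow> Dom C f = a \<Longrightarrow> Cod C f = b \<Longrightarrow>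
    LUnit C b \<cdot> (Id C (UnitO C) \<odot> f) \<cdot> Inv C (LUnit C a) = f"
  by (subst Comp_rewrite2[OF LUnit_nat]) auto

lemma RUnit_conjugate:
  "f \<in> Arr C \<Longrightarrow> Dom C f = a \<Longrightarrow> Cod C f = b \<Longrightarrow>
    RUnit C b \<cdot> (f \<odot> Id C (UnitO C)) \<cdot> Inv C (RUnit C a) = f"
  by (subst Comp_rewrite2[OF RUnit_nat]) auto

text \<open>Precomposing with \<open>?e\<close>, which \<open>rebracket_assoc\<close> expresses in
  two ways, removes all inverses and leaves naturality of the associator. The outcome is strict
  associativity of the product of arrows in the strictification.\<close>

lemma rebracket_Ten_assoc:
  assumes [simp]: "as \<in> lists (Obj C)" "bs \<in> lists (Obj C)" "cs \<in> lists (Obj C)"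
    "as' \<in> lists (Obj C)" "bs' \<in> lists (Obj C)" "cs' \<in> lists (Obj C)"
    "f \<in> Arr C" "g \<in> Arr C" "h \<in> Arr C"
    "Dom C f = tens C as" "Dom C g = tens C bs" "Dom C h = tens C cs"
    "Cod C f = tens C as'" "Cod C g = tens C bs'" "Cod C h = tens C cs'"
  shows "rebracket C (as' @ bs') cs' \<cdot>
      ((rebracket C as' bs' \<cdot> (f \<odot> g) \<cdot> Inv C (rebracket C as bs)) \<odot> h) \<cdot>
      Inv C (rebracket C (as @ bs) cs) =
    rebracket C as' (bs' @ cs') \<cdot>
      (f \<odot> (rebracket C bs' cs' \<cdot> (g \<odot> h) \<cdot> Inv C (rebracket C bs cs))) \<cdot>
      Inv C (rebracket C as (bs @ cs))" (is "?l = ?r")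
proof (rule cancel_right)
  let ?e = "rebracket C (as @ bs) cs \<cdot> (rebracket C as bs \<odot> Id C (tens C cs))"
  have "?l \<cdot> ?e = rebracket C (as' @ bs') cs' \<cdot> ((rebracket C as' bs' \<cdot> (f \<odot> g)) \<odot> h)"
    by (simp add: Comp_assoc_arr Comp_Ten)
  also have "\<dots> = (rebracket C (as' @ bs') cs' \<cdot> (rebracket C as' bs' \<odot> Id C (tens C cs'))) \<cdot> ((f \<odot> g) \<odot> h)"
    by (simp add: Comp_assoc_arr Comp_Ten)
  also have "\<dots> = rebracket C as' (bs' @ cs') \<cdot> (Id C (tens C as') \<odot> rebracket C bs' cs') \<cdot>
      (f \<odot> (g \<odot> h)) \<cdot> Assoc C (tens C as) (tens C bs) (tens C cs)"
    unfolding rebracket_assoc[OF assms(4-6)] by (simp add: Comp_assoc_arr Assoc_nat)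
  also have "\<dots> = ?r \<cdot> (rebracket C as (bs @ cs) \<cdot> (Id C (tens C as) \<odot> rebracket C bs cs) \<cdot>
      Assoc C (tens C as) (tens C bs) (tens C cs))"
    by (simp add: Comp_assoc_arr Comp_Ten')
  finally show "?l \<cdot> ?e = ?r \<cdot> ?e"
    unfolding rebracket_assoc[OF assms(1-3)] .
qed simp_all

text \<open>The three associators in the hexagon of \<open>C\<close> are traded for rebracketings by
  three instances of \<open>rebracket_assoc\<close>, for the orders \<open>as, bs, cs\<close>, then
  \<open>bs, cs, as\<close> and \<open>bs, as, cs\<close>. In the strictification, where associators
  are identities, the result is the hexagon axiom.\<close>

lemma rebracket_hexagon:
  assumes [simp]: "as \<in> lists (Obj C)" "bs \<in> lists (Obj C)" "cs \<in> lists (Obj C)"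
  shows "rebracket C (bs @ cs) as \<cdot> Braid C (tens C as) (tens C (bs @ cs)) \<cdot> Inv C (rebracket C as (bs @ cs)) =
    (rebracket C bs (cs @ as) \<cdot> (Id C (tens C bs) \<odot> (rebracket C cs as \<cdot>
       Braid C (tens C as) (tens C cs) \<cdot> Inv C (rebracket C as cs))) \<cdot> Inv C (rebracket C bs (as @ cs))) \<cdot>
    (rebracket C (bs @ as) cs \<cdot> ((rebracket C bs as \<cdot> Braid C (tens C as) (tens C bs) \<cdot>
       Inv C (rebracket C as bs)) \<odot> Id C (tens C cs)) \<cdot> Inv C (rebracket C (as @ bs) cs))"
    (is "?l = ?r1 \<cdot> ?r2")
proof (rule cancel_right)
  let ?A = "tens C as" and ?B = "tens C bs" and ?C = "tens C cs"
  let ?e = "rebracket C (as @ bs) cs \<cdot> (rebracket C as bs \<odot> Id C ?C)"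
  have "?l \<cdot> ?e = rebracket C (bs @ cs) as \<cdot> (Braid C ?A (tens C (bs @ cs)) \<cdot>
      (Id C ?A \<odot> rebracket C bs cs)) \<cdot> Assoc C ?A ?B ?C"
    unfolding rebracket_assoc[OF assms] by (simp add: Comp_assoc_arr)
  also have "\<dots> = (rebracket C (bs @ cs) as \<cdot> (rebracket C bs cs \<odot> Id C ?A)) \<cdot>
      Braid C ?A (?B \<otimes> ?C) \<cdot> Assoc C ?A ?B ?C"
    by (simp add: Comp_assoc_arr Braid_nat)
  also have "\<dots> = rebracket C bs (cs @ as) \<cdot> (Id C ?B \<odot> rebracket C cs as) \<cdot>
      (Assoc C ?B ?C ?A \<cdot> Braid C ?A (?B \<otimes> ?C) \<cdot> Assoc C ?A ?B ?C)"
    unfolding rebracket_assoc[OF assms(2,3,1)] by (simp add: Comp_assoc_arr)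
  also have "\<dots> = rebracket C bs (cs @ as) \<cdot> (Id C ?B \<odot> rebracket C cs as) \<cdot>
      (Id C ?B \<odot> Braid C ?A ?C) \<cdot> Assoc C ?B ?A ?C \<cdot> (Braid C ?A ?B \<odot> Id C ?C)"
    by (simp add: hexagon)
  also have "\<dots> = ?r1 \<cdot> (rebracket C bs (as @ cs) \<cdot> (Id C ?B \<odot> rebracket C as cs) \<cdot>
      Assoc C ?B ?A ?C) \<cdot> (Braid C ?A ?B \<odot> Id C ?C)"
    by (simp add: Comp_assoc_arr Comp_Ten')
  also have "\<dots> = ?r1 \<cdot> (rebracket C (bs @ as) cs \<cdot> (rebracket C bs as \<odot> Id C ?C)) \<cdot>
      (Braid C ?A ?B \<odot> Id C ?C)"
    by (simp only: rebracket_assoc[OF assms(2,1,3)])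
  also have "\<dots> = (?r1 \<cdot> ?r2) \<cdot> ?e"
    by (simp add: Comp_assoc_arr Comp_Ten' Comp_Ten)
  finally show "?l \<cdot> ?e = (?r1 \<cdot> ?r2) \<cdot> ?e" .
qed simp_all

lemma rebracket_Braid_natural:
  assumes [simp]: "as \<in> lists (Obj C)" "bs \<in> lists (Obj C)" "as' \<in> lists (Obj C)" "bs' \<in> lists (Obj C)"
    "f \<in> Arr C" "g \<in> Arr C"
    "Dom C f = tens C as" "Dom C g = tens C bs" "Cod C f = tens C as'" "Cod C g = tens C bs'"
  shows "(rebracket C bs' as' \<cdot> Braid C (tens C as') (tens C bs') \<cdot> Inv C (rebracket C as' bs')) \<cdot>
      (rebracket C as' bs' \<cdot> (f \<odot> g) \<cdot> Inv C (rebracket C as bs)) =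
    (rebracket C bs' as' \<cdot> (g \<odot> f) \<cdot> Inv C (rebracket C bs as)) \<cdot>
      (rebracket C bs as \<cdot> Braid C (tens C as) (tens C bs) \<cdot> Inv C (rebracket C as bs))"
proof -
  have "(Braid C (tens C as') (tens C bs') \<cdot> (f \<odot> g)) \<cdot> Inv C (rebracket C as bs) =
    ((g \<odot> f) \<cdot> Braid C (tens C as) (tens C bs)) \<cdot> Inv C (rebracket C as bs)"
    by (simp add: Braid_nat)
  then show ?thesis
    by (simp add: Comp_assoc_arr)
qed

text \<open>With identity structure maps, naturality of associator and unitors turns into strict
  associativity and unitality of the product of arrows; there, and in the braiding axioms, the
  identities for \<open>rebracket\<close> enter.\<close>

lemma symmetric_strict_monoidal_category_strictification:
  "symmetric_strict_monoidal_category (strictification C)"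
proof -
  interpret S: category "strictification C"
    by (rule category_strictification)
  have iso_Id: "iso (strictification C) as as (as, as, Id C (tens C as))" if "as \<in> lists (Obj C)" for as
    using that S.invertible_Id[of as] by (simp add: iso_iff)
  have Braid_Braid': "rebracket C as bs \<cdot> Braid C (tens C bs) (tens C as) \<cdot> Braid C (tens C as) (tens C bs) \<cdot>
      Inv C (rebracket C as bs) = Id C (tens C (as @ bs))"
    if [simp]: "as \<in> lists (Obj C)" "bs \<in> lists (Obj C)" for as bs
  proof -
    have "(Braid C (tens C bs) (tens C as) \<cdot> Braid C (tens C as) (tens C bs)) \<cdot> Inv C (rebracket C as bs) =
      Inv C (rebracket C as bs)"
      by (subst Braid_Braid) simp_all
    then show ?thesis
      by (simp add: Comp_assoc_arr)
  qed
  show ?thesis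
  proof (unfold_locales, goal_cases)
    case (2 a b)
    then show ?case by simp
  next
    case (3 f a b g c d)
    then show ?case
      by (elim hom_strictificationE) (simp add: in_hom_iff)
  next
    case (5 f a b f' c g a' b' g' c')
    then show ?case
      by (elim hom_strictificationE) (simp add: Comp_assoc_arr Comp_Ten')
  next
    case (6 a b c)
    then show ?case by (simp add: iso_Id)
  next
    case (9 f a a' g b b' h c c')
    then show ?case
      by (elim hom_strictificationE) (simp add: rebracket_Ten_assoc)
  next
    case (10 f a b)
    then show ?case
      by (elim hom_strictificationE) (simp add: rebracket_Nil_left LUnit_conjugate)
  next
    case (11 f a b)
    then show ?case
      by (elim hom_strictificationE) (simp add: rebracket_Nil_right RUnit_conjugate)
  next
    case (12 a b c d)
    then show ?case by simp
  next
    case (13 a b)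
    then show ?case by simp
  next
    case (14 a b)
    then show ?case by (simp add: in_hom_iff)
  next
    case (15 f a a' g b b')
    then show ?case
      by (elim hom_strictificationE) (simp add: rebracket_Braid_natural)
  next
    case (16 a b c)
    then show ?case
      using rebracket_hexagon[of a b c] by simp
  next
    case (17 a b)
    then show ?case by (simp add: Comp_assoc_arr Braid_Braid')
  qed (simp_all add: iso_Id)
qed

end

section \<open>Strong monoidal functors and shuffles\<close>

lemma (in is_supply) supply_arr:
  assumes "c \<in> Obj C" "\<mu> \<in> hom P m n"
  shows "FM (s c) \<mu> \<in> Arr C" "Dom C (FM (s c) \<mu>) = pow C c m" "Cod C (FM (s c) \<mu>) = pow C c n"
  using strong_monoidal_functor.FM_hom[OF supply_functor[OF assms(1)] assms(2)] assms(1)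
  by (auto simp: in_hom_iff supply_obj)

context strong_monoidal_functor
begin

lemma FO_Obj [simp]: "a \<in> Obj C \<Longrightarrow> FO F a \<in> Obj D"
  by (rule FO_obj)

lemma FM_arr [simp]:
  assumes "f \<in> Arr C"
  shows "FM F f \<in> Arr D" "Dom D (FM F f) = FO F (Dom C f)" "Cod D (FM F f) = FO F (Cod C f)"
  using FM_hom[of f "Dom C f" "Cod C f"] assms by (auto simp: in_hom_iff)

lemma FM_Comp':
  "f \<in> Arr C \<Longrightarrow> g \<in> Arr C \<Longrightarrow> Cod C f = Dom C g \<Longrightarrow>
    FM F (g \<cdot>\<^bsub>C\<^esub> f) = FM F g \<cdot>\<^bsub>D\<^esub> FM F f"
  by (rule FM_Comp) (auto simp: in_hom_iff)

lemma inverse_arrows_FM: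
  assumes "invertible C f"
  shows "inverse_arrows D (FM F f) (FM F (Inv C f))"
  using assms invertible_arr[OF assms] FM_Comp'[of f "Inv C f"] FM_Comp'[of "Inv C f" f]
  by (simp add: inverse_arrows_def in_hom_iff FM_Id)

lemma FM_Inv: "invertible C f \<Longrightarrow> FM F (Inv C f) = Inv D (FM F f)"
  by (rule D.Inv_eqI[OF inverse_arrows_FM, symmetric])

lemma invertible_FM [simp]: "invertible C f \<Longrightarrow> invertible D (FM F f)"
  using inverse_arrows_FM invertible_def by metis

lemma Str0_arr [simp]:
  "invertible D (Str0 F)" "Str0 F \<in> Arr D" "Dom D (Str0 F) = UnitO D" "Cod D (Str0 F) = FO F (UnitO C)"
  using Str0_iso by (auto simp: iso_iff invertible_arr)

lemma Str2_arr [simp]: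
  assumes "a \<in> Obj C" "b \<in> Obj C"
  shows "invertible D (Str2 F a b)" "Str2 F a b \<in> Arr D"
    "Dom D (Str2 F a b) = FO F a \<otimes>\<^bsub>D\<^esub> FO F b" "Cod D (Str2 F a b) = FO F (a \<otimes>\<^bsub>C\<^esub> b)"
  using Str2_iso[OF assms] by (auto simp: iso_iff invertible_arr)

lemma Str2_nat:
  "\<lbrakk>f \<in> Arr C; g \<in> Arr C\<rbrakk> \<Longrightarrow>
    FM F (f \<odot>\<^bsub>C\<^esub> g) \<cdot>\<^bsub>D\<^esub> Str2 F (Dom C f) (Dom C g) =
    Str2 F (Cod C f) (Cod C g) \<cdot>\<^bsub>D\<^esub> (FM F f \<odot>\<^bsub>D\<^esub> FM F g)"
  by (rule Str2_natural[symmetric]) (auto simp: in_hom_iff)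

lemma FM_Ten_Str2:
  "\<lbrakk>f \<in> Arr C; g \<in> Arr C; Dom C f = a; Dom C g = b; x \<in> Arr D; Cod D x = FO F a \<otimes>\<^bsub>D\<^esub> FO F b\<rbrakk> \<Longrightarrow>
    FM F (f \<odot>\<^bsub>C\<^esub> g) \<cdot>\<^bsub>D\<^esub> (Str2 F a b \<cdot>\<^bsub>D\<^esub> x) =
    Str2 F (Cod C f) (Cod C g) \<cdot>\<^bsub>D\<^esub> ((FM F f \<odot>\<^bsub>D\<^esub> FM F g) \<cdot>\<^bsub>D\<^esub> x)"
  by (rule D.Comp_rewrite2) (auto simp: Str2_nat)

lemma FM_Inv_Assoc:
  assumes [simp]: "a \<in> Obj C" "b \<in> Obj C" "c \<in> Obj C"
  shows "FM F (Inv C (Assoc C a b c)) \<cdot>\<^bsub>D\<^esub> Str2 F a (b \<otimes>\<^bsub>C\<^esub> c) \<cdot>\<^bsub>D\<^esub> (Id D (FO F a) \<odot>\<^bsub>D\<^esub> Str2 F b c) =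
    Str2 F (a \<otimes>\<^bsub>C\<^esub> b) c \<cdot>\<^bsub>D\<^esub> (Str2 F a b \<odot>\<^bsub>D\<^esub> Id D (FO F c)) \<cdot>\<^bsub>D\<^esub>
      Inv D (Assoc D (FO F a) (FO F b) (FO F c))"
proof -
  have "FM F (Inv C (Assoc C a b c)) \<cdot>\<^bsub>D\<^esub> (Str2 F a (b \<otimes>\<^bsub>C\<^esub> c) \<cdot>\<^bsub>D\<^esub> (Id D (FO F a) \<odot>\<^bsub>D\<^esub> Str2 F b c) \<cdot>\<^bsub>D\<^esub>
      Assoc D (FO F a) (FO F b) (FO F c)) \<cdot>\<^bsub>D\<^esub> Inv D (Assoc D (FO F a) (FO F b) (FO F c)) =
    FM F (Inv C (Assoc C a b c)) \<cdot>\<^bsub>D\<^esub> (FM F (Assoc C a b c) \<cdot>\<^bsub>D\<^esub> Str2 F (a \<otimes>\<^bsub>C\<^esub> b) c \<cdot>\<^bsub>D\<^esub>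
      (Str2 F a b \<odot>\<^bsub>D\<^esub> Id D (FO F c))) \<cdot>\<^bsub>D\<^esub> Inv D (Assoc D (FO F a) (FO F b) (FO F c))"
    by (simp add: Str_assoc)
  then show ?thesis
    by (simp add: FM_Inv D.Comp_assoc_arr)
qed

text \<open>An interchange is an associator, a block around one braiding, and an inverse associator.
  The functor transports each piece by its own axiom, and the squares \<open>outer\<close>,
  \<open>middle\<close> and \<open>last\<close> are pasted together.\<close>

lemma FM_interchange:
  assumes [simp]: "a \<in> Obj C" "b \<in> Obj C" "c \<in> Obj C" "d \<in> Obj C"
  shows "FM F (interchange C a b c d) \<cdot>\<^bsub>D\<^esub> Str2 F (a \<otimes>\<^bsub>C\<^esub> b) (c \<otimes>\<^bsub>C\<^esub> d) \<cdot>\<^bsub>D\<^esub> (Str2 F a b \<odot>\<^bsub>D\<^esub> Str2 F c d) =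
    Str2 F (a \<otimes>\<^bsub>C\<^esub> c) (b \<otimes>\<^bsub>C\<^esub> d) \<cdot>\<^bsub>D\<^esub> (Str2 F a c \<odot>\<^bsub>D\<^esub> Str2 F b d) \<cdot>\<^bsub>D\<^esub>
      interchange D (FO F a) (FO F b) (FO F c) (FO F d)"
proof -
  let ?F = "FO F" and ?s = "Str2 F"
  define m where "m = Assoc C c b d \<cdot>\<^bsub>C\<^esub> (Braid C b c \<odot>\<^bsub>C\<^esub> Id C d) \<cdot>\<^bsub>C\<^esub> Inv C (Assoc C b c d)"
  define m' where "m' = Assoc D (?F c) (?F b) (?F d) \<cdot>\<^bsub>D\<^esub> (Braid D (?F b) (?F c) \<odot>\<^bsub>D\<^esub> Id D (?F d)) \<cdot>\<^bsub>D\<^esub>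
    Inv D (Assoc D (?F b) (?F c) (?F d))"
  have eq: "interchange C a b c d =
      Inv C (Assoc C a c (b \<otimes>\<^bsub>C\<^esub> d)) \<cdot>\<^bsub>C\<^esub> (Id C a \<odot>\<^bsub>C\<^esub> m) \<cdot>\<^bsub>C\<^esub> Assoc C a b (c \<otimes>\<^bsub>C\<^esub> d)"
    "interchange D (?F a) (?F b) (?F c) (?F d) =
      Inv D (Assoc D (?F a) (?F c) (?F b \<otimes>\<^bsub>D\<^esub> ?F d)) \<cdot>\<^bsub>D\<^esub> (Id D (?F a) \<odot>\<^bsub>D\<^esub> m') \<cdot>\<^bsub>D\<^esub>
      Assoc D (?F a) (?F b) (?F c \<otimes>\<^bsub>D\<^esub> ?F d)"
    by (simp_all only: interchange_def m_def m'_def)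
  have m [simp]: "m \<in> Arr C" "Dom C m = b \<otimes>\<^bsub>C\<^esub> (c \<otimes>\<^bsub>C\<^esub> d)" "Cod C m = c \<otimes>\<^bsub>C\<^esub> (b \<otimes>\<^bsub>C\<^esub> d)"
    "m' \<in> Arr D" "Dom D m' = ?F b \<otimes>\<^bsub>D\<^esub> (?F c \<otimes>\<^bsub>D\<^esub> ?F d)" "Cod D m' = ?F c \<otimes>\<^bsub>D\<^esub> (?F b \<otimes>\<^bsub>D\<^esub> ?F d)"
    by (simp_all add: m_def m'_def)
  \<comment> \<open>\<open>Str_assoc\<close> accepts a strongator only next to an identity.
    Splitting the product exposes such a factor and leaves an arrow that naturality of the
    associator moves away.\<close>
  have split: "?s x y \<odot>\<^bsub>D\<^esub> ?s z w = (?s x y \<odot>\<^bsub>D\<^esub> Id D (?F (z \<otimes>\<^bsub>C\<^esub> w))) \<cdot>\<^bsub>D\<^esub>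
      ((Id D (?F x) \<odot>\<^bsub>D\<^esub> Id D (?F y)) \<odot>\<^bsub>D\<^esub> ?s z w)"
    if [simp]: "x \<in> Obj C" "y \<in> Obj C" "z \<in> Obj C" "w \<in> Obj C" for x y z w
    by (simp add: D.Comp_Ten)
  have outer: "FM F (Assoc C x y (z \<otimes>\<^bsub>C\<^esub> w)) \<cdot>\<^bsub>D\<^esub> ?s (x \<otimes>\<^bsub>C\<^esub> y) (z \<otimes>\<^bsub>C\<^esub> w) \<cdot>\<^bsub>D\<^esub> (?s x y \<odot>\<^bsub>D\<^esub> ?s z w) =
    ?s x (y \<otimes>\<^bsub>C\<^esub> (z \<otimes>\<^bsub>C\<^esub> w)) \<cdot>\<^bsub>D\<^esub>
      (Id D (?F x) \<odot>\<^bsub>D\<^esub> (?s y (z \<otimes>\<^bsub>C\<^esub> w) \<cdot>\<^bsub>D\<^esub> (Id D (?F y) \<odot>\<^bsub>D\<^esub> ?s z w))) \<cdot>\<^bsub>D\<^esub>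
      Assoc D (?F x) (?F y) (?F z \<otimes>\<^bsub>D\<^esub> ?F w)"
    if [simp]: "x \<in> Obj C" "y \<in> Obj C" "z \<in> Obj C" "w \<in> Obj C" for x y z w
  proof -
    have "FM F (Assoc C x y (z \<otimes>\<^bsub>C\<^esub> w)) \<cdot>\<^bsub>D\<^esub> ?s (x \<otimes>\<^bsub>C\<^esub> y) (z \<otimes>\<^bsub>C\<^esub> w) \<cdot>\<^bsub>D\<^esub> (?s x y \<odot>\<^bsub>D\<^esub> ?s z w) =
      (FM F (Assoc C x y (z \<otimes>\<^bsub>C\<^esub> w)) \<cdot>\<^bsub>D\<^esub> ?s (x \<otimes>\<^bsub>C\<^esub> y) (z \<otimes>\<^bsub>C\<^esub> w) \<cdot>\<^bsub>D\<^esub>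
        (?s x y \<odot>\<^bsub>D\<^esub> Id D (?F (z \<otimes>\<^bsub>C\<^esub> w)))) \<cdot>\<^bsub>D\<^esub> ((Id D (?F x) \<odot>\<^bsub>D\<^esub> Id D (?F y)) \<odot>\<^bsub>D\<^esub> ?s z w)"
      unfolding split[OF that] by (simp add: D.Comp_assoc_arr del: D.Ten_Id')
    also have "\<dots> = (?s x (y \<otimes>\<^bsub>C\<^esub> (z \<otimes>\<^bsub>C\<^esub> w)) \<cdot>\<^bsub>D\<^esub> (Id D (?F x) \<odot>\<^bsub>D\<^esub> ?s y (z \<otimes>\<^bsub>C\<^esub> w)) \<cdot>\<^bsub>D\<^esub>
        Assoc D (?F x) (?F y) (?F (z \<otimes>\<^bsub>C\<^esub> w))) \<cdot>\<^bsub>D\<^esub> ((Id D (?F x) \<odot>\<^bsub>D\<^esub> Id D (?F y)) \<odot>\<^bsub>D\<^esub> ?s z w)"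
      by (simp only: Str_assoc that C.Ten_Obj)
    also have "\<dots> = ?s x (y \<otimes>\<^bsub>C\<^esub> (z \<otimes>\<^bsub>C\<^esub> w)) \<cdot>\<^bsub>D\<^esub>
      (Id D (?F x) \<odot>\<^bsub>D\<^esub> (?s y (z \<otimes>\<^bsub>C\<^esub> w) \<cdot>\<^bsub>D\<^esub> (Id D (?F y) \<odot>\<^bsub>D\<^esub> ?s z w))) \<cdot>\<^bsub>D\<^esub>
      Assoc D (?F x) (?F y) (?F z \<otimes>\<^bsub>D\<^esub> ?F w)"
      by (simp add: D.Comp_assoc_arr D.Assoc_nat D.Comp_Ten' del: D.Ten_Id')
    finally show ?thesis .
  qed
  have middle: "FM F m \<cdot>\<^bsub>D\<^esub> ?s b (c \<otimes>\<^bsub>C\<^esub> d) \<cdot>\<^bsub>D\<^esub> (Id D (?F b) \<odot>\<^bsub>D\<^esub> ?s c d) =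
    ?s c (b \<otimes>\<^bsub>C\<^esub> d) \<cdot>\<^bsub>D\<^esub> (Id D (?F c) \<odot>\<^bsub>D\<^esub> ?s b d) \<cdot>\<^bsub>D\<^esub> m'"
  proof -
    have "FM F m \<cdot>\<^bsub>D\<^esub> ?s b (c \<otimes>\<^bsub>C\<^esub> d) \<cdot>\<^bsub>D\<^esub> (Id D (?F b) \<odot>\<^bsub>D\<^esub> ?s c d) =
      FM F (Assoc C c b d) \<cdot>\<^bsub>D\<^esub> FM F (Braid C b c \<odot>\<^bsub>C\<^esub> Id C d) \<cdot>\<^bsub>D\<^esub>
      (FM F (Inv C (Assoc C b c d)) \<cdot>\<^bsub>D\<^esub> ?s b (c \<otimes>\<^bsub>C\<^esub> d) \<cdot>\<^bsub>D\<^esub> (Id D (?F b) \<odot>\<^bsub>D\<^esub> ?s c d))"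
      by (simp add: m_def FM_Comp' D.Comp_assoc_arr)
    also have "\<dots> = FM F (Assoc C c b d) \<cdot>\<^bsub>D\<^esub> ?s (c \<otimes>\<^bsub>C\<^esub> b) d \<cdot>\<^bsub>D\<^esub>
      ((FM F (Braid C b c) \<cdot>\<^bsub>D\<^esub> ?s b c) \<odot>\<^bsub>D\<^esub> Id D (?F d)) \<cdot>\<^bsub>D\<^esub> Inv D (Assoc D (?F b) (?F c) (?F d))"
      by (simp add: FM_Inv_Assoc FM_Ten_Str2 D.Comp_Ten' FM_Id)
    also have "\<dots> = (FM F (Assoc C c b d) \<cdot>\<^bsub>D\<^esub> ?s (c \<otimes>\<^bsub>C\<^esub> b) d \<cdot>\<^bsub>D\<^esub> (?s c b \<odot>\<^bsub>D\<^esub> Id D (?F d))) \<cdot>\<^bsub>D\<^esub>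
      (Braid D (?F b) (?F c) \<odot>\<^bsub>D\<^esub> Id D (?F d)) \<cdot>\<^bsub>D\<^esub> Inv D (Assoc D (?F b) (?F c) (?F d))"
      by (simp add: Str_braid D.Comp_assoc_arr D.Comp_Ten')
    also have "\<dots> = ?s c (b \<otimes>\<^bsub>C\<^esub> d) \<cdot>\<^bsub>D\<^esub> (Id D (?F c) \<odot>\<^bsub>D\<^esub> ?s b d) \<cdot>\<^bsub>D\<^esub> m'"
      by (simp add: Str_assoc m'_def D.Comp_assoc_arr)
    finally show ?thesis .
  qed
  \<comment> \<open>The square \<open>outer\<close> read backwards, with both associators
    inverted.\<close>
  have last: "FM F (Inv C (Assoc C a c (b \<otimes>\<^bsub>C\<^esub> d))) \<cdot>\<^bsub>D\<^esub> ?s a (c \<otimes>\<^bsub>C\<^esub> (b \<otimes>\<^bsub>C\<^esub> d)) \<cdot>\<^bsub>D\<^esub>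
      (Id D (?F a) \<odot>\<^bsub>D\<^esub> (?s c (b \<otimes>\<^bsub>C\<^esub> d) \<cdot>\<^bsub>D\<^esub> (Id D (?F c) \<odot>\<^bsub>D\<^esub> ?s b d))) =
    ?s (a \<otimes>\<^bsub>C\<^esub> c) (b \<otimes>\<^bsub>C\<^esub> d) \<cdot>\<^bsub>D\<^esub> (?s a c \<odot>\<^bsub>D\<^esub> ?s b d) \<cdot>\<^bsub>D\<^esub> Inv D (Assoc D (?F a) (?F c) (?F b \<otimes>\<^bsub>D\<^esub> ?F d))"
    by (rule D.cancel_right[of _ "Assoc D (?F a) (?F c) (?F b \<otimes>\<^bsub>D\<^esub> ?F d)"])
      (simp_all add: D.Comp_assoc_arr FM_Inv flip: outer)
  have "FM F (interchange C a b c d) \<cdot>\<^bsub>D\<^esub> ?s (a \<otimes>\<^bsub>C\<^esub> b) (c \<otimes>\<^bsub>C\<^esub> d) \<cdot>\<^bsub>D\<^esub> (?s a b \<odot>\<^bsub>D\<^esub> ?s c d) =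
    FM F (Inv C (Assoc C a c (b \<otimes>\<^bsub>C\<^esub> d))) \<cdot>\<^bsub>D\<^esub> FM F (Id C a \<odot>\<^bsub>C\<^esub> m) \<cdot>\<^bsub>D\<^esub>
    (FM F (Assoc C a b (c \<otimes>\<^bsub>C\<^esub> d)) \<cdot>\<^bsub>D\<^esub> ?s (a \<otimes>\<^bsub>C\<^esub> b) (c \<otimes>\<^bsub>C\<^esub> d) \<cdot>\<^bsub>D\<^esub> (?s a b \<odot>\<^bsub>D\<^esub> ?s c d))"
    unfolding eq by (simp add: FM_Comp' D.Comp_assoc_arr)
  also have "\<dots> = FM F (Inv C (Assoc C a c (b \<otimes>\<^bsub>C\<^esub> d))) \<cdot>\<^bsub>D\<^esub> ?s a (c \<otimes>\<^bsub>C\<^esub> (b \<otimes>\<^bsub>C\<^esub> d)) \<cdot>\<^bsub>D\<^esub>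
    (Id D (?F a) \<odot>\<^bsub>D\<^esub> (FM F m \<cdot>\<^bsub>D\<^esub> ?s b (c \<otimes>\<^bsub>C\<^esub> d) \<cdot>\<^bsub>D\<^esub> (Id D (?F b) \<odot>\<^bsub>D\<^esub> ?s c d))) \<cdot>\<^bsub>D\<^esub>
    Assoc D (?F a) (?F b) (?F c \<otimes>\<^bsub>D\<^esub> ?F d)"
    by (simp add: outer FM_Ten_Str2 D.Comp_Ten' FM_Id)
  also have "\<dots> = (FM F (Inv C (Assoc C a c (b \<otimes>\<^bsub>C\<^esub> d))) \<cdot>\<^bsub>D\<^esub> ?s a (c \<otimes>\<^bsub>C\<^esub> (b \<otimes>\<^bsub>C\<^esub> d)) \<cdot>\<^bsub>D\<^esub>
    (Id D (?F a) \<odot>\<^bsub>D\<^esub> (?s c (b \<otimes>\<^bsub>C\<^esub> d) \<cdot>\<^bsub>D\<^esub> (Id D (?F c) \<odot>\<^bsub>D\<^esub> ?s b d)))) \<cdot>\<^bsub>D\<^esub>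
    (Id D (?F a) \<odot>\<^bsub>D\<^esub> m') \<cdot>\<^bsub>D\<^esub> Assoc D (?F a) (?F b) (?F c \<otimes>\<^bsub>D\<^esub> ?F d)"
    unfolding middle by (simp add: D.Comp_assoc_arr D.Comp_Ten')
  also have "\<dots> = ?s (a \<otimes>\<^bsub>C\<^esub> c) (b \<otimes>\<^bsub>C\<^esub> d) \<cdot>\<^bsub>D\<^esub> (?s a c \<odot>\<^bsub>D\<^esub> ?s b d) \<cdot>\<^bsub>D\<^esub>
      interchange D (?F a) (?F b) (?F c) (?F d)"
    unfolding last eq by (simp add: D.Comp_assoc_arr)
  finally show ?thesis .
qed

lemma iterated_strongator_arr:
  assumes [simp]: "c \<in> Obj C"
  shows "invertible D (iterated_strongator C D F c n) \<and>
    Dom D (iterated_strongator C D F c n) = pow D (FO F c) n \<and>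
    Cod D (iterated_strongator C D F c n) = FO F (pow C c n)"
  by (induction n rule: induct_nat_012) (auto simp: invertible_arr)

lemmas iterated_strongator_simps [simp] =
  iterated_strongator_arr[THEN conjunct1]
  iterated_strongator_arr[THEN conjunct2, THEN conjunct1]
  iterated_strongator_arr[THEN conjunct2, THEN conjunct2]
  iterated_strongator_arr[THEN conjunct1, THEN invertible_arr]

text \<open>Shuffles are transported one interchange at a time. The hypotheses make \<open>F\<close>
  strict at the single product of \<open>c\<close> and \<open>d\<close>, so that no comparison
  between powers of \<open>FO F c \<otimes> FO F d\<close> and of
  \<open>FO F (c \<otimes> d)\<close> intervenes. The tensor functor satisfies them when one object
  is appended to a nonempty list.\<close>

lemma FM_shuffle:
  assumes [simp]: "c \<in> Obj C" "d \<in> Obj C"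
    and FO [simp]: "FO F (c \<otimes>\<^bsub>C\<^esub> d) = FO F c \<otimes>\<^bsub>D\<^esub> FO F d"
    and Str2 [simp]: "Str2 F c d = Id D (FO F c \<otimes>\<^bsub>D\<^esub> FO F d)"
  shows "FM F (shuffle C c d n) \<cdot>\<^bsub>D\<^esub> Str2 F (pow C c n) (pow C d n) \<cdot>\<^bsub>D\<^esub>
      (iterated_strongator C D F c n \<odot>\<^bsub>D\<^esub> iterated_strongator C D F d n) =
    iterated_strongator C D F (c \<otimes>\<^bsub>C\<^esub> d) n \<cdot>\<^bsub>D\<^esub> shuffle D (FO F c) (FO F d) n"
proof (induction n rule: induct_nat_012)
  case 0
  \<comment> \<open>At exponent zero both shuffles are unitors; the product of two
    \<open>Str0\<close> is split so that the factor in \<open>Str_lunit\<close> appears.\<close>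
  have "FM F (LUnit C (UnitO C)) \<cdot>\<^bsub>D\<^esub> Str2 F (UnitO C) (UnitO C) \<cdot>\<^bsub>D\<^esub> (Str0 F \<odot>\<^bsub>D\<^esub> Str0 F) =
    (FM F (LUnit C (UnitO C)) \<cdot>\<^bsub>D\<^esub> Str2 F (UnitO C) (UnitO C) \<cdot>\<^bsub>D\<^esub> (Str0 F \<odot>\<^bsub>D\<^esub> Id D (FO F (UnitO C)))) \<cdot>\<^bsub>D\<^esub>
    (Id D (UnitO D) \<odot>\<^bsub>D\<^esub> Str0 F)"
    by (simp add: D.Comp_assoc_arr D.Comp_Ten)
  then show ?case
    by (simp add: Str_lunit D.LUnit_nat)
next
  case 1
  then show ?case by (simp add: FM_Id)
next
  case (ge2 n)
  let ?n = "Suc n" and ?F = "FO F" and ?s = "Str2 F"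
  let ?c = "pow C c ?n" and ?d = "pow C d ?n" and ?it = "iterated_strongator C D F"
  have "FM F (shuffle C c d (Suc ?n)) \<cdot>\<^bsub>D\<^esub> ?s (pow C c (Suc ?n)) (pow C d (Suc ?n)) \<cdot>\<^bsub>D\<^esub>
      (?it c (Suc ?n) \<odot>\<^bsub>D\<^esub> ?it d (Suc ?n)) =
    FM F (shuffle C c d ?n \<odot>\<^bsub>C\<^esub> Id C (c \<otimes>\<^bsub>C\<^esub> d)) \<cdot>\<^bsub>D\<^esub>
    (FM F (interchange C ?c c ?d d) \<cdot>\<^bsub>D\<^esub> ?s (?c \<otimes>\<^bsub>C\<^esub> c) (?d \<otimes>\<^bsub>C\<^esub> d) \<cdot>\<^bsub>D\<^esub> (?s ?c c \<odot>\<^bsub>D\<^esub> ?s ?d d)) \<cdot>\<^bsub>D\<^esub>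
    ((?it c ?n \<odot>\<^bsub>D\<^esub> Id D (?F c)) \<odot>\<^bsub>D\<^esub> (?it d ?n \<odot>\<^bsub>D\<^esub> Id D (?F d)))"
    by (simp add: FM_Comp' D.Comp_assoc_arr D.Comp_Ten)
  also have "\<dots> = FM F (shuffle C c d ?n \<odot>\<^bsub>C\<^esub> Id C (c \<otimes>\<^bsub>C\<^esub> d)) \<cdot>\<^bsub>D\<^esub> ?s (?c \<otimes>\<^bsub>C\<^esub> ?d) (c \<otimes>\<^bsub>C\<^esub> d) \<cdot>\<^bsub>D\<^esub>
    (?s ?c ?d \<odot>\<^bsub>D\<^esub> ?s c d) \<cdot>\<^bsub>D\<^esub> (interchange D (?F ?c) (?F c) (?F ?d) (?F d) \<cdot>\<^bsub>D\<^esub>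
    ((?it c ?n \<odot>\<^bsub>D\<^esub> Id D (?F c)) \<odot>\<^bsub>D\<^esub> (?it d ?n \<odot>\<^bsub>D\<^esub> Id D (?F d))))"
    unfolding FM_interchange[OF C.pow_Obj[OF assms(1)] assms(1) C.pow_Obj[OF assms(2)] assms(2)]
    by (simp add: D.Comp_assoc_arr)
  \<comment> \<open>Naturality lets the interchange act first; the shorter iterates then meet in the
    first tensor factor, in the shape of the induction hypothesis.\<close>
  also have "\<dots> = ?s (pow C (c \<otimes>\<^bsub>C\<^esub> d) ?n) (c \<otimes>\<^bsub>C\<^esub> d) \<cdot>\<^bsub>D\<^esub>
    ((FM F (shuffle C c d ?n) \<cdot>\<^bsub>D\<^esub> ?s ?c ?d \<cdot>\<^bsub>D\<^esub> (?it c ?n \<odot>\<^bsub>D\<^esub> ?it d ?n)) \<odot>\<^bsub>D\<^esub> Id D (?F c \<otimes>\<^bsub>D\<^esub> ?F d)) \<cdot>\<^bsub>D\<^esub>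
    interchange D (pow D (?F c) ?n) (?F c) (pow D (?F d) ?n) (?F d)"
    by (simp add: D.interchange_natural FM_Ten_Str2 D.Comp_Ten' FM_Id)
  also have "\<dots> = ?it (c \<otimes>\<^bsub>C\<^esub> d) (Suc ?n) \<cdot>\<^bsub>D\<^esub> shuffle D (?F c) (?F d) (Suc ?n)"
    unfolding ge2 by (simp add: D.Comp_assoc_arr D.Comp_Ten')
  finally show ?case .
qed

text \<open>The two instances of \<open>supply_tensor\<close>, in \<open>D\<close> and in
  \<open>C\<close>, express the actions on the product through shuffles, and
  \<open>FM_shuffle\<close> matches these. The shuffle in \<open>D\<close> is invertible and
  cancels.\<close>

lemma preserves_supply_Ten:
  assumes s: "is_supply P C s" and t: "is_supply P D t"
    and [simp]: "c \<in> Obj C" "d \<in> Obj C" and \<mu>: "\<mu> \<in> hom P m n"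
    and FO [simp]: "FO F (c \<otimes>\<^bsub>C\<^esub> d) = FO F c \<otimes>\<^bsub>D\<^esub> FO F d"
    and Str2: "Str2 F c d = Id D (FO F c \<otimes>\<^bsub>D\<^esub> FO F d)"
    and pres: "\<And>e. e \<in> {c, d} \<Longrightarrow> iterated_strongator C D F e n \<cdot>\<^bsub>D\<^esub> FM (t (FO F e)) \<mu> =
      FM F (FM (s e) \<mu>) \<cdot>\<^bsub>D\<^esub> iterated_strongator C D F e m"
  shows "iterated_strongator C D F (c \<otimes>\<^bsub>C\<^esub> d) n \<cdot>\<^bsub>D\<^esub> FM (t (FO F (c \<otimes>\<^bsub>C\<^esub> d))) \<mu> =
    FM F (FM (s (c \<otimes>\<^bsub>C\<^esub> d)) \<mu>) \<cdot>\<^bsub>D\<^esub> iterated_strongator C D F (c \<otimes>\<^bsub>C\<^esub> d) m"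
proof (rule D.cancel_right)
  interpret s: is_supply P C s by (rule s)
  interpret t: is_supply P D t by (rule t)
  note [simp] = s.supply_arr[OF _ \<mu>] t.supply_arr[OF _ \<mu>]
  let ?F = "FO F" and ?it = "iterated_strongator C D F"
  let ?sh = "shuffle D (?F c) (?F d)"
  have "(?it (c \<otimes>\<^bsub>C\<^esub> d) n \<cdot>\<^bsub>D\<^esub> FM (t (?F (c \<otimes>\<^bsub>C\<^esub> d))) \<mu>) \<cdot>\<^bsub>D\<^esub> ?sh m =
    (?it (c \<otimes>\<^bsub>C\<^esub> d) n \<cdot>\<^bsub>D\<^esub> ?sh n) \<cdot>\<^bsub>D\<^esub> (FM (t (?F c)) \<mu> \<odot>\<^bsub>D\<^esub> FM (t (?F d)) \<mu>)"
    using \<mu> by (simp add: t.supply_tensor D.Comp_assoc_arr)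
  also have "\<dots> = FM F (shuffle C c d n) \<cdot>\<^bsub>D\<^esub> Str2 F (pow C c n) (pow C d n) \<cdot>\<^bsub>D\<^esub>
    ((?it c n \<cdot>\<^bsub>D\<^esub> FM (t (?F c)) \<mu>) \<odot>\<^bsub>D\<^esub> (?it d n \<cdot>\<^bsub>D\<^esub> FM (t (?F d)) \<mu>))"
    using FM_shuffle[OF assms(3,4) FO Str2, of n, symmetric] by (simp add: D.Comp_assoc_arr D.Comp_Ten)
  also have "\<dots> = (FM F (shuffle C c d n) \<cdot>\<^bsub>D\<^esub> FM F (FM (s c) \<mu> \<odot>\<^bsub>C\<^esub> FM (s d) \<mu>)) \<cdot>\<^bsub>D\<^esub>
    Str2 F (pow C c m) (pow C d m) \<cdot>\<^bsub>D\<^esub> (?it c m \<odot>\<^bsub>D\<^esub> ?it d m)"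
    by (simp add: pres D.Comp_assoc_arr FM_Ten_Str2 D.Comp_Ten)
  also have "\<dots> = (FM F (FM (s (c \<otimes>\<^bsub>C\<^esub> d)) \<mu>) \<cdot>\<^bsub>D\<^esub> FM F (shuffle C c d m)) \<cdot>\<^bsub>D\<^esub>
    Str2 F (pow C c m) (pow C d m) \<cdot>\<^bsub>D\<^esub> (?it c m \<odot>\<^bsub>D\<^esub> ?it d m)"
    using s.supply_tensor[OF assms(3,4) \<mu>, symmetric]
      FM_Comp'[of "FM (s c) \<mu> \<odot>\<^bsub>C\<^esub> FM (s d) \<mu>" "shuffle C c d n"]
      FM_Comp'[of "shuffle C c d m" "FM (s (c \<otimes>\<^bsub>C\<^esub> d)) \<mu>"]
    by simp
  also have "\<dots> = (FM F (FM (s (c \<otimes>\<^bsub>C\<^esub> d)) \<mu>) \<cdot>\<^bsub>D\<^esub> ?it (c \<otimes>\<^bsub>C\<^esub> d) m) \<cdot>\<^bsub>D\<^esub> ?sh m"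
    using FM_shuffle[OF assms(3,4) FO Str2, of m] by (simp add: D.Comp_assoc_arr)
  finally show "(?it (c \<otimes>\<^bsub>C\<^esub> d) n \<cdot>\<^bsub>D\<^esub> FM (t (?F (c \<otimes>\<^bsub>C\<^esub> d))) \<mu>) \<cdot>\<^bsub>D\<^esub> ?sh m =
    (FM F (FM (s (c \<otimes>\<^bsub>C\<^esub> d)) \<mu>) \<cdot>\<^bsub>D\<^esub> ?it (c \<otimes>\<^bsub>C\<^esub> d) m) \<cdot>\<^bsub>D\<^esub> ?sh m" .
qed (use is_supply.supply_arr[OF s _ \<mu>] is_supply.supply_arr[OF t _ \<mu>] FO_Obj[of c] FO_Obj[of d]
    in \<open>simp_all del: FO_Obj\<close>)

end

section \<open>The induced supply\<close>

text \<open>All structure maps entering \<open>rebracket\<close> are identities here. This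
  reconciles the identity strongators of the induced supply with
  \<open>supply_strongator\<close>.\<close>

lemma (in symmetric_strict_monoidal_category) rebracket_strict:
  assumes "as \<in> lists (Obj C)" "bs \<in> lists (Obj C)"
  shows "rebracket C as bs = Id C (tens C (as @ bs))"
proof (cases "as = []")
  case True
  then show ?thesis using assms by (simp add: rebracket_Nil_left)
next
  case False
  show ?thesis using assms(2)
  proof (induction bs rule: rev_induct)
    case Nil
    then show ?case using assms by (simp add: rebracket_Nil_right)
  next
    case (snoc b bs)
    then have "tens C (as @ bs @ [b]) = tens C as \<otimes> (tens C bs \<otimes> b)"
      using assms by (simp add: tens_append tens_snoc_strict)
    then show ?case
      using snoc assms False
      by (cases "bs = []") (auto simp: rebracket_single rebracket_snoc tens_append)
  qed
qed

context prop_in_strict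
begin

lemma strict_model_functor:
  assumes [simp]: "a \<in> Obj C" and f: "strict_model a f"
  shows "strong_monoidal_functor P C
    \<lparr>FO = pow C a, FM = f, Str0 = Id C (UnitO C), Str2 = (\<lambda>m n. Id C (pow C a (m + n)))\<rparr>"
proof -
  note arr = strict_model_arr[OF f]
  have Id: "f (Id P n) = Id C (pow C a n)"
    and Comp: "\<mu> \<in> Arr P \<Longrightarrow> \<nu> \<in> Arr P \<Longrightarrow> Cod P \<mu> = Dom P \<nu> \<Longrightarrow> f (\<nu> \<cdot>\<^bsub>P\<^esub> \<mu>) = f \<nu> \<cdot> f \<mu>"
    and Ten: "\<mu> \<in> Arr P \<Longrightarrow> \<nu> \<in> Arr P \<Longrightarrow> f (\<mu> \<odot>\<^bsub>P\<^esub> \<nu>) = f \<mu> \<odot> f \<nu>"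
    and Braid: "f (Braid P m n) = Braid C (pow C a m) (pow C a n)" for \<mu> \<nu> m n
    using f by (auto simp: strict_model_def)
  show ?thesis
  proof (unfold_locales, goal_cases)
    case (2 \<mu> m n)
    then show ?case by (simp add: in_hom_iff arr)
  next
    case (4 \<mu> m n \<nu> k)
    then show ?case by (simp add: in_hom_iff Comp)
  next
    case (7 \<mu> m m' \<nu> n n')
    then have "f \<mu> \<odot> f \<nu> \<in> Arr C" "Dom C (f \<mu> \<odot> f \<nu>) = pow C a (m + n)"
      "Cod C (f \<mu> \<odot> f \<nu>) = pow C a (m' + n')" "f (\<mu> \<odot>\<^bsub>P\<^esub> \<nu>) = f \<mu> \<odot> f \<nu>"
      by (auto simp: in_hom_iff Ten arr pow_add)
    then show ?case by simp
  qed (simp_all add: Id Braid iso_iff pow_add)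
qed

end

text \<open>The associator upstairs is an identity, so the associativity axiom is the cocycle
  identity \<open>rebracket_assoc\<close>. Compatibility with products and braidings is built in:
  the strictification defines both by conjugation with these strongators.\<close>

lemma (in symmetric_monoidal_category) strong_monoidal_functor_tensor_functor:
  "strong_monoidal_functor (strictification C) C (tensor_functor C)"
proof -
  interpret S: symmetric_strict_monoidal_category "strictification C"
    by (rule symmetric_strict_monoidal_category_strictification)
  have simps [simp]: "FO (tensor_functor C) = tens C" "FM (tensor_functor C) (as, bs, f) = f"
    "Str0 (tensor_functor C) = Id C (UnitO C)" "Str2 (tensor_functor C) = rebracket C" for as bs f
    by (simp_all add: tensor_functor_def)
  show ?thesis
  proof (unfold_locales, goal_cases)
    case (2 f a b)
    then show ?case by (elim hom_strictificationE) (simp add: in_hom_iff)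
  next
    case (4 f a b g c)
    then show ?case by (elim hom_strictificationE) simp
  next
    case (7 f a a' g b b')
    then show ?case by (elim hom_strictificationE) (simp add: Comp_assoc_arr)
  next
    case (8 a b c)
    then show ?case using rebracket_assoc[of a b c] by simp
  qed (simp_all add: iso_iff rebracket_Nil_left rebracket_Nil_right Comp_assoc_arr)
qed

section \<open>The induced supply and its preservation by the tensor functor\<close>

context is_supply
begin

sublocale S: prop_in_strict P "strictification C"
  by (intro prop_in_strict.intro P.prop_category_axioms
      C.symmetric_strict_monoidal_category_strictification)

abbreviation "S \<equiv> strictification C"

lemma pow_singleton: "pow S [c] n = replicate n c"
  by (induction n rule: induct_nat_012) (simp_all add: replicate_append_same)

lemma tens_singletons: "tens S (map (\<lambda>c. [c]) cs) = cs"
proof (induction cs rule: rev_induct)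
  case (snoc c cs)
  then show ?case by (cases "cs = []") (simp_all add: S.tens_snoc)
qed simp

text \<open>By \<open>supply_strongator\<close>, the strongators of \<open>s c\<close> are the maps
  \<open>rebracket\<close> that conjugate products and braidings in the strictification. Solving
  their naturality and symmetry for the value of the functor gives strict preservation of
  both.\<close>

lemma strict_model_singleton:
  assumes [simp]: "c \<in> Obj C"
  shows "S.strict_model [c] (singleton_supply_mor P s c)"
proof -
  interpret F: strong_monoidal_functor P C "s c"
    by (rule supply_functor) simp
  have FO: "FO (s c) m = tens C (replicate m c)" for m
    by (simp add: supply_obj pow_def)
  have rep [simp]: "replicate m c \<in> lists (Obj C)" for m by auto
  show ?thesis
    unfolding S.strict_model_def
  proof (intro conjI ballI allI impI, goal_cases)
    case (1 \<mu>)
    then show ?case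
      by (simp add: singleton_supply_mor_def in_hom_iff pow_singleton FO)
  next
    case (2 n)
    then show ?case
      by (simp add: singleton_supply_mor_def pow_singleton F.FM_Id FO)
  next
    case (3 \<mu> \<nu>)
    then show ?case
      by (simp add: singleton_supply_mor_def F.FM_Comp')
  next
    case (4 \<mu> \<nu>)
    have "FM (s c) (\<mu> \<odot>\<^bsub>P\<^esub> \<nu>) =
      (rebracket C (replicate (Cod P \<mu>) c) (replicate (Cod P \<nu>) c) \<cdot>\<^bsub>C\<^esub> (FM (s c) \<mu> \<odot>\<^bsub>C\<^esub> FM (s c) \<nu>)) \<cdot>\<^bsub>C\<^esub>
      Inv C (rebracket C (replicate (Dom P \<mu>) c) (replicate (Dom P \<nu>) c))"
      by (rule C.eq_Comp_Inv)
        (use 4 F.Str2_nat[of \<mu> \<nu>] in \<open>simp_all add: supply_strongator FO replicate_add\<close>)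
    then show ?case
      using 4 by (simp add: singleton_supply_mor_def C.Comp_assoc_arr FO replicate_add)
  next
    case (5 m n)
    have "FM (s c) (Braid P m n) =
      (rebracket C (replicate n c) (replicate m c) \<cdot>\<^bsub>C\<^esub>
        Braid C (tens C (replicate m c)) (tens C (replicate n c))) \<cdot>\<^bsub>C\<^esub>
      Inv C (rebracket C (replicate m c) (replicate n c))"
      by (rule C.eq_Comp_Inv)
        (use F.Str_braid[of m n] in \<open>simp_all add: supply_strongator FO replicate_add\<close>)
    then show ?case
      by (simp add: singleton_supply_mor_def C.Comp_assoc_arr replicate_add pow_singleton)
  qed
qed

text \<open>\<open>multi_product\<close> takes a family indexed by objects of the strictification,
  which are lists; \<open>hd\<close> recovers \<open>c\<close> from \<open>[c]\<close>.\<close>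

lemma induced_supply_eq:
  "induced_supply P C s cs =
    \<lparr>FO = pow S cs,
     FM = S.multi_product (\<lambda>x. singleton_supply_mor P s (hd x)) (map (\<lambda>c. [c]) cs),
     Str0 = Id S (UnitO S), Str2 = (\<lambda>m n. Id S (pow S cs (m + n)))\<rparr>"
  by (simp add: induced_supply_def Let_def S.multi_product_def fun_eq_iff comp_def)

lemma singletons:
  "(\<lambda>c. [c]) ` Obj C \<subseteq> Obj S"
  "x \<in> (\<lambda>c. [c]) ` Obj C \<Longrightarrow> S.strict_model x (singleton_supply_mor P s (hd x))"
  "cs \<in> lists (Obj C) \<Longrightarrow> map (\<lambda>c. [c]) cs \<in> lists ((\<lambda>c. [c]) ` Obj C)"
  using strict_model_singleton by auto

lemma FM_induced_supply_single:
  "c \<in> Obj C \<Longrightarrow> \<mu> \<in> Arr P \<Longrightarrow> FM (induced_supply P C s [c]) \<mu> = singleton_supply_mor P s c \<mu>"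
  using S.multi_product_single[OF singletons(1,2), of "[c]" \<mu>] by (simp add: induced_supply_eq)

lemma FM_induced_supply_model:
  "cs \<in> lists (Obj C) \<Longrightarrow> S.strict_model cs (FM (induced_supply P C s cs))"
  using S.strict_model_multi_product[OF singletons(1,2) singletons(3)[of cs]]
  by (simp add: induced_supply_eq tens_singletons)

lemma FM_induced_supply_append:
  "cs \<in> lists (Obj C) \<Longrightarrow> ds \<in> lists (Obj C) \<Longrightarrow> \<mu> \<in> Arr P \<Longrightarrow>
    FM (induced_supply P C s (cs @ ds)) \<mu> =
    S.shuffle_product cs ds (FM (induced_supply P C s cs)) (FM (induced_supply P C s ds)) \<mu>"
  using S.multi_product_append[OF singletons(1,2) singletons(3)[of cs] singletons(3)[of ds], of \<mu>]
  by (simp add: induced_supply_eq tens_singletons)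

text \<open>On a concatenation the action is a shuffle product by
  \<open>FM_induced_supply_append\<close>, and \<open>supply_tensor\<close> is its defining square
  \<open>shuffle_product_shuffle\<close>. On the empty list the action is constantly the identity,
  which gives \<open>supply_unit\<close>.\<close>

lemma is_supply_induced_supply: "is_supply P S (induced_supply P C s)"
proof (intro is_supply.intro is_supply_axioms.intro P.prop_category_axioms
    S.symmetric_monoidal_category_axioms, goal_cases)
  case (1 cs)
  then show ?case
    using S.strict_model_functor[OF _ FM_induced_supply_model[of cs]] by (simp add: induced_supply_eq)
next
  case (2 cs m)
  then show ?case by (simp add: induced_supply_eq)
next
  case (3 cs m n)
  then have "replicate k cs \<in> lists (Obj S)" for k by auto
  then show ?case
    by (simp add: induced_supply_eq S.rebracket_strict pow_def replicate_add)
next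
  case (4 cs ds \<mu> m n)
  then show ?case
    using S.shuffle_product_shuffle[OF _ _ FM_induced_supply_model[of cs] FM_induced_supply_model[of ds], of \<mu>]
    by (auto simp: in_hom_iff FM_induced_supply_append)
next
  case (5 \<mu> m n)
  then show ?case
    by (simp add: induced_supply_eq S.multi_product_Nil)
qed

lemma tensor_functor_preserves:
  assumes "cs \<in> lists (Obj C)" and \<mu>: "\<mu> \<in> hom P m n"
  shows "iterated_strongator S C (tensor_functor C) cs n \<cdot>\<^bsub>C\<^esub> FM (s (FO (tensor_functor C) cs)) \<mu> =
    FM (tensor_functor C) (FM (induced_supply P C s cs) \<mu>) \<cdot>\<^bsub>C\<^esub>
      iterated_strongator S C (tensor_functor C) cs m"
proof -
  interpret F: strong_monoidal_functor S C "tensor_functor C"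
    by (rule C.strong_monoidal_functor_tensor_functor)
  let ?it = "iterated_strongator S C (tensor_functor C)"
  have F [simp]: "FO (tensor_functor C) = tens C" "FM (tensor_functor C) (as, bs, f) = f"
    "Str0 (tensor_functor C) = Id C (UnitO C)" "Str2 (tensor_functor C) = rebracket C" for as bs f
    by (simp_all add: tensor_functor_def)
  have \<mu>' [simp]: "\<mu> \<in> Arr P" "Dom P \<mu> = m" "Cod P \<mu> = n"
    using \<mu> by (simp_all add: in_hom_iff)
  have single: "?it [c] n \<cdot>\<^bsub>C\<^esub> FM (s (tens C [c])) \<mu> =
    FM (tensor_functor C) (FM (induced_supply P C s [c]) \<mu>) \<cdot>\<^bsub>C\<^esub> ?it [c] m" if [simp]: "c \<in> Obj C" for c
  proof -
    \<comment> \<open>Beyond exponent one, each strongator in the iterate appends a single factor to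
      a nonempty list and is thus an identity.\<close>
    have "?it [c] k = Id C (pow C c k)" for k
    proof (induction k rule: induct_nat_012)
      case (ge2 k)
      have "pow S [c] (Suc k) = replicate (Suc k) c" "tens C (c # replicate k c) = pow C c (Suc k)"
        by (simp_all only: pow_singleton) (simp add: pow_def)
      then show ?case
        using ge2 by (simp add: C.rebracket_single)
    qed simp_all
    then show ?thesis
      by (simp add: FM_induced_supply_single singleton_supply_mor_def supply_arr[OF _ \<mu>])
  qed
  show ?thesis
    using assms(1)
  proof (induction cs rule: rev_induct)
    case Nil
    have it [simp]: "?it [] k \<in> Arr C" "Dom C (?it [] k) = pow C (UnitO C) k" "Cod C (?it [] k) = UnitO C" for k
      using F.iterated_strongator_simps[of "[]" k] S.pow_Unit[of k] by simp_all
    \<comment> \<open>For the empty list the iterate merges \<open>k\<close> units into one and so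
      undoes \<open>unit_shuffle\<close>. Cancelling this shuffle turns \<open>supply_unit\<close>
      for \<open>s\<close> into the claim.\<close>
    have inverse: "?it [] k \<cdot>\<^bsub>C\<^esub> unit_shuffle C k = Id C (UnitO C)" for k
    proof (induction k rule: induct_nat_012)
      case (ge2 k)
      have "pow S [] (Suc k) = []"
        using S.pow_Unit[of "Suc k"] by simp
      then have "?it [] (Suc (Suc k)) \<cdot>\<^bsub>C\<^esub> unit_shuffle C (Suc (Suc k)) =
        LUnit C (UnitO C) \<cdot>\<^bsub>C\<^esub> ((?it [] (Suc k) \<cdot>\<^bsub>C\<^esub> unit_shuffle C (Suc k)) \<odot>\<^bsub>C\<^esub> Id C (UnitO C)) \<cdot>\<^bsub>C\<^esub>
          Inv C (LUnit C (UnitO C))"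
        by (simp add: C.rebracket_Nil_left C.Comp_assoc_arr C.Comp_Ten')
      then show ?case
        unfolding ge2 by simp
    qed simp_all
    have "?it [] n \<cdot>\<^bsub>C\<^esub> FM (s (UnitO C)) \<mu> = ?it [] m"
    proof (rule C.cancel_right)
      show "(?it [] n \<cdot>\<^bsub>C\<^esub> FM (s (UnitO C)) \<mu>) \<cdot>\<^bsub>C\<^esub> unit_shuffle C m = ?it [] m \<cdot>\<^bsub>C\<^esub> unit_shuffle C m"
        by (simp add: C.Comp_assoc_arr supply_arr[OF _ \<mu>] supply_unit[OF \<mu>] inverse)
    qed (simp_all add: supply_arr[OF _ \<mu>])
    then show ?case
      by (simp add: induced_supply_eq S.multi_product_Nil)
  next
    case (snoc c cs)
    then have [simp]: "c \<in> Obj C" "cs \<in> lists (Obj C)" by auto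
    \<comment> \<open>\<open>preserves_supply_Ten\<close> asks for an identity strongator, but
      appending \<open>c\<close> to the empty list has the left unitor of \<open>c\<close> as
      strongator; lists of length one are therefore settled by \<open>single\<close>.\<close>
    show ?case
    proof (cases "cs = []")
      case True
      then show ?thesis using single[of c] by simp
    next
      case False
      have "?it e n \<cdot>\<^bsub>C\<^esub> FM (s (FO (tensor_functor C) e)) \<mu> =
          FM (tensor_functor C) (FM (induced_supply P C s e) \<mu>) \<cdot>\<^bsub>C\<^esub> ?it e m" if "e \<in> {cs, [c]}" for e
        using that snoc single[of c] by auto
      moreover have "FO (tensor_functor C) (cs \<otimes>\<^bsub>S\<^esub> [c]) =
          FO (tensor_functor C) cs \<otimes>\<^bsub>C\<^esub> FO (tensor_functor C) [c]"
        "Str2 (tensor_functor C) cs [c] = Id C (FO (tensor_functor C) cs \<otimes>\<^bsub>C\<^esub> FO (tensor_functor C) [c])"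
        using False by (simp_all add: C.tens_snoc C.rebracket_single)
      ultimately have "?it (cs \<otimes>\<^bsub>S\<^esub> [c]) n \<cdot>\<^bsub>C\<^esub> FM (s (FO (tensor_functor C) (cs \<otimes>\<^bsub>S\<^esub> [c]))) \<mu> =
          FM (tensor_functor C) (FM (induced_supply P C s (cs \<otimes>\<^bsub>S\<^esub> [c])) \<mu>) \<cdot>\<^bsub>C\<^esub> ?it (cs \<otimes>\<^bsub>S\<^esub> [c]) m"
        by (intro F.preserves_supply_Ten[OF is_supply_induced_supply is_supply_axioms _ _ \<mu>]) simp_all
      then show ?thesis by simp
    qed
  qed
qed

end

theorem corollary4p10:
  fixes P :: "(nat, 'p) smc"
    and C :: "('o, 'm) smc"
    and s :: "'o \<Rightarrow> (nat, 'p, 'o, 'm) mfunctor"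
  assumes "prop_category P"
    and "symmetric_monoidal_category C"
    and "is_supply P C s"
  shows "preserves_supply P (strictification C) (induced_supply P C s) C s (tensor_functor C)"
proof -
  interpret is_supply P C s by (rule assms(3))
  show ?thesis
    by (intro preserves_supply.intro preserves_supply_axioms.intro is_supply_induced_supply
        assms(3) C.strong_monoidal_functor_tensor_functor tensor_functor_preserves) simp_all
qed

end
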